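(* Let $p\in(0,1)$ be a constant and let $G_n\sim G(n,p)$. Let $X_n$ denote the maximum number of edges of a chordal subgraph of $G_n$. Let $\gamma=\gamma(p)$ be the unique solution in the interval $(\max\{1,2p\},2)$ of the equation $$\gamma\ln\frac{2}{\gamma}+(2-\gamma)\ln\frac{2}{2-\gamma}=(2-\gamma)\ln\frac{1}{1-p}-(1-\gamma)\ln\frac{1}{p}.$$ Then with probability tending to $1$ as $n\to\infty$, $$\left|X_n-\gamma\, n\log_{1/p} n\right|\leq 10\, n\log_{1/p}\ln n.$$
   Context: A graph is chordal if it contains no induced cycle of length at least 4. $G(n,p)$ is the binomial random graph on vertex set $[n]=\{1,\dots,n\}$ in which each pair is an edge independently with probability $p$. A subgraph here need not be induced. *)

theory Defs
  imports Complex_Main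
begin

text \<open>Graphs on vertex set [n] = {1..n} are represented by their edge sets,
  i.e. sets of 2-element subsets of {1..n}.\<close>

definition all_pairs :: "nat \<Rightarrow> nat set set" where
  "all_pairs n = {e. \<exists>i j. i \<in> {1..n} \<and> j \<in> {1..n} \<and> i \<noteq> j \<and> e = {i, j}}"

definition chordal :: "nat set set \<Rightarrow> bool" where
  "chordal F \<longleftrightarrow>
     \<not> (\<exists>cs :: nat list. length cs \<ge> 4 \<and> distinct cs \<and>
          (\<forall>i < length cs. \<forall>j < length cs. i \<noteq> j \<longrightarrow>
             ({cs ! i, cs ! j} \<in> F \<longleftrightarrow>
                (j = Suc i mod length cs \<or> i = Suc j mod length cs))))"

definition max_chordal_edges :: "nat set set \<Rightarrow> nat" where
  "max_chordal_edges E = Max {card F | F. F \<subseteq> E \<and> chordal F}"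

definition prob_Gnp :: "nat \<Rightarrow> real \<Rightarrow> (nat set set \<Rightarrow> bool) \<Rightarrow> real" where
  "prob_Gnp n p P =
     (\<Sum>E \<in> Pow (all_pairs n).
        if P E then p ^ card E * (1 - p) ^ (card (all_pairs n) - card E) else 0)"

definition gamma_eq :: "real \<Rightarrow> real \<Rightarrow> bool" where
  "gamma_eq p g \<longleftrightarrow>
     g * ln (2 / g) + (2 - g) * ln (2 / (2 - g)) =
     (2 - g) * ln (1 / (1 - p)) - (1 - g) * ln (1 / p)"

definition gamma :: "real \<Rightarrow> real" where
  "gamma p = (THE g. max 1 (2 * p) < g \<and> g < 2 \<and> gamma_eq p g)"

end

theory Submission
  imports Defs "HOL-Library.FuncSet" "HOL-Real_Asymp.Real_Asymp"
begin

text \<open>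
  Put \<open>x = \<gamma>/2\<close>, \<open>L = log\<^bsub>1/p\<^esub> n\<close> and \<open>\<lambda> = log\<^bsub>1/p\<^esub> (ln n)\<close>. The equation for \<open>\<gamma>\<close> says that the
  relative entropy \<open>x ln (x/p) + (1-x) ln ((1-x)/(1-p))\<close> equals \<open>ln (1/p) / 2\<close>; hence a given set of
  about \<open>2L\<close> vertices contains at least \<open>2xL\<close> neighbours of a new vertex with probability about \<open>1/n\<close>.

  Upper bound: by Dirac's theorem a chordal \<open>F\<close> has a perfect elimination ordering. If \<open>\<pi> v\<close> is the
  last earlier neighbour of \<open>v\<close>, then the earlier neighbours of \<open>v\<close> lie in \<open>\<pi> v\<close> together with
  the earlier neighbours of \<open>\<pi> v\<close>, a clique and so of size at most \<open>2L + 2\<close> with high probability. Hence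
  for fixed \<open>\<pi>\<close> the number of edges is dominated by a sum of independent binomials; an exponential moment
  bound beats the at most \<open>n^n\<close> functions \<open>\<pi>\<close>.

  Lower bound: the second moment method yields \<open>n / polylog n\<close> disjoint cliques of size
  \<open>2L - 10\<lambda>\<close> on the first \<open>n / ln n\<close> vertices. Almost all other vertices have at least a fraction \<open>x\<close>
  of one of these cliques as neighbours, and joining each to such a subset gives a chordal graph.
\<close>


section \<open>Random subsets of a finite set\<close>

text \<open>The value of \<gamma> comes from balancing exponents: a union bound over parent
  functions costs a factor \<open>n\<close> per vertex, and the equation for \<gamma> says that the
  moment bound with about \<open>2L\<close> trials gains exactly this factor. The obstacle in the
  upper bound is that \<open>F\<close> is chosen after the random graph \<open>E\<close> is seen,
  and that the possible earlier neighbours of a vertex depend on \<open>E\<close> as well. Fixing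
  \<pi> removes the choice: \<pi> and \<open>E\<close> alone determine back neighbourhoods that
  contain those of \<open>F\<close>, and exposing \<open>E\<close> along \<pi> makes each of them a
  binomial subset of a set already known. The error term plays two roles. Above,
  \<open>10 * \<lambda>\<close> only has to beat a bounded cost per vertex. Below, shortening the
  cliques by \<open>10 * \<lambda>\<close> multiplies the chance of attaching a vertex by
  \<open>(ln n)^5\<close>, which outweighs the powers of \<open>ln n\<close> lost in the size of the
  clique family and in the local binomial estimate. The shortening costs only
  \<open>10 * x * \<lambda>\<close> edges per vertex, and \<open>x < 1\<close> leaves room for all
  other losses.\<close>

definition bern :: "real \<Rightarrow> 'a set \<Rightarrow> ('a set \<Rightarrow> real) \<Rightarrow> real" where
  "bern p A f = (\<Sum>E\<in>Pow A. p ^ card E * (1 - p) ^ (card A - card E) * f E)"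

lemma bern_empty [simp]: "bern p {} f = f {}"
  by (simp add: bern_def)

text \<open>Conditions on the membership of the single element \<open>a\<close>. Here
  \<open>bern p A f\<close> is the expectation of \<open>f\<close> at a random subset of
  \<open>A\<close>; probabilities are expectations of \<open>of_bool\<close>, so that every argument
  is about a finite sum.\<close>

lemma bern_insert:
  assumes "finite A" "a \<notin> A"
  shows "bern p (insert a A) f = (1 - p) * bern p A f + p * bern p A (\<lambda>E. f (insert a E))"
proof -
  have disj: "Pow A \<inter> insert a ` Pow A = {}" and inj: "inj_on (insert a) (Pow A)"
    using assms by (auto simp: inj_on_def)
  have fin: "finite E" "card E \<le> card A" "a \<notin> E" if "E \<in> Pow A" for E
    using that assms by (auto intro: finite_subset card_mono)
  have "bern p (insert a A) f = (\<Sum>E\<in>Pow A. p ^ card E * (1 - p) ^ (Suc (card A) - card E) * f E)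
     + (\<Sum>E\<in>Pow A. p ^ card (insert a E) * (1 - p) ^ (Suc (card A) - card (insert a E)) * f (insert a E))"
    using assms disj inj
    by (simp add: bern_def Pow_insert sum.union_disjoint sum.reindex)
  also have "(\<Sum>E\<in>Pow A. p ^ card E * (1 - p) ^ (Suc (card A) - card E) * f E) = (1 - p) * bern p A f"
    unfolding bern_def sum_distrib_left
    by (rule sum.cong) (use fin in \<open>auto simp: Suc_diff_le\<close>)
  also have "(\<Sum>E\<in>Pow A. p ^ card (insert a E) * (1 - p) ^ (Suc (card A) - card (insert a E)) * f (insert a E))
      = p * bern p A (\<lambda>E. f (insert a E))"
    unfolding bern_def sum_distrib_left
    by (rule sum.cong) (use fin in \<open>auto\<close>)
  finally show ?thesis .
qed

lemma bern_cong:
  "(\<And>E. E \<subseteq> A \<Longrightarrow> f E = g E) \<Longrightarrow> bern p A f = bern p A g"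
  unfolding bern_def by (rule sum.cong) auto

text \<open>Fubini for the product measure: exposing the edges in two rounds, and the independence
  of disjoint edge sets, rest on this identity.\<close>

lemma bern_Un:
  assumes "finite A" "finite B" "A \<inter> B = {}"
  shows "bern p (A \<union> B) f = bern p A (\<lambda>E. bern p B (\<lambda>D. f (E \<union> D)))"
  using assms(1,3)
proof (induction A arbitrary: f rule: finite_induct)
  case empty
  then show ?case by simp
next
  case (insert a A)
  then show ?case
    using assms(2) by (simp add: bern_insert)
qed

lemma bern_mono:
  assumes "0 \<le> p" "p \<le> 1" "\<And>E. E \<subseteq> A \<Longrightarrow> f E \<le> g E"
  shows "bern p A f \<le> bern p A g"
  unfolding bern_def using assms by (intro sum_mono mult_left_mono) auto

lemma bern_cmult: "bern p A (\<lambda>E. c * f E) = c * bern p A f"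
  by (simp add: bern_def sum_distrib_left mult_ac)

lemma bern_cmult_right: "bern p A (\<lambda>E. f E * c) = bern p A f * c"
  using bern_cmult[of p A c f] by (simp only: mult.commute)

lemma bern_add: "bern p A (\<lambda>E. f E + g E) = bern p A f + bern p A g"
  by (simp add: bern_def sum.distrib algebra_simps)

lemma bern_diff: "bern p A (\<lambda>E. f E - g E) = bern p A f - bern p A g"
  by (simp add: bern_def sum_subtractf algebra_simps)

lemma bern_sum: "bern p A (\<lambda>E. \<Sum>i\<in>I. f i E) = (\<Sum>i\<in>I. bern p A (f i))"
  unfolding bern_def sum_distrib_left by (rule sum.swap)

lemma bern_const [simp]: "finite A \<Longrightarrow> bern p A (\<lambda>_. c) = c"
  by (induction A rule: finite_induct) (simp_all add: bern_insert algebra_simps)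

lemma bern_nonneg:
  "0 \<le> p \<Longrightarrow> p \<le> 1 \<Longrightarrow> (\<And>E. E \<subseteq> A \<Longrightarrow> 0 \<le> f E) \<Longrightarrow> 0 \<le> bern p A f"
  unfolding bern_def by (intro sum_nonneg mult_nonneg_nonneg) auto

text \<open>The probability generating function of a binomial variable, used with
  \<open>t \<ge> 1\<close> as an exponential moment.\<close>

lemma bern_power_card:
  assumes "finite A" "D \<subseteq> A"
  shows "bern p A (\<lambda>E. t ^ card (E \<inter> D)) = (1 - p + p * t) ^ card D"
proof -
  have fD: "finite D" using assms finite_subset by blast
  have "bern p D (\<lambda>E. t ^ card E) = (1 - p + p * t) ^ card D"
    using fD
  proof (induction D rule: finite_induct)
    case (insert a D)
    have "bern p D (\<lambda>E. t ^ card (insert a E)) = bern p D (\<lambda>E. t * t ^ card E)"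
    proof (rule bern_cong)
      fix E assume "E \<subseteq> D"
      then have "finite E" "a \<notin> E"
        using insert finite_subset by auto
      then show "t ^ card (insert a E) = t * t ^ card E" by simp
    qed
    then show ?case
      using insert by (simp add: bern_insert bern_cmult algebra_simps)
  qed simp
  moreover have "bern p (D \<union> (A - D)) (\<lambda>E. t ^ card (E \<inter> D)) =
      bern p D (\<lambda>E. bern p (A - D) (\<lambda>E'. t ^ card ((E \<union> E') \<inter> D)))"
    using assms fD by (intro bern_Un) auto
  moreover have "bern p D (\<lambda>E. bern p (A - D) (\<lambda>E'. t ^ card ((E \<union> E') \<inter> D)))
     = bern p D (\<lambda>E. bern p (A - D) (\<lambda>E'. t ^ card E))"
    by (intro bern_cong arg_cong[where f = "\<lambda>x. t ^ card x"]) auto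
  ultimately show ?thesis
    using assms by (simp add: Un_absorb1)
qed

lemma bern_superset:
  assumes "finite A" "D \<subseteq> A"
  shows "bern p A (\<lambda>E. of_bool (D \<subseteq> E)) = p ^ card D"
proof -
  have fD: "finite D" using assms finite_subset by blast
  have "bern p D (\<lambda>E. of_bool (D \<subseteq> E)) = p ^ card D"
  proof -
    have "bern p D (\<lambda>E. of_bool (D \<subseteq> E)) = (\<Sum>E\<in>{D}. p ^ card E * (1 - p) ^ (card D - card E))"
      unfolding bern_def using fD by (intro sum.mono_neutral_cong_right) auto
    then show ?thesis by simp
  qed
  moreover have "bern p (D \<union> (A - D)) (\<lambda>E. of_bool (D \<subseteq> E)) =
      bern p D (\<lambda>E. bern p (A - D) (\<lambda>E'. of_bool (D \<subseteq> E \<union> E')))"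
    using assms fD by (intro bern_Un) auto
  moreover have "bern p D (\<lambda>E. bern p (A - D) (\<lambda>E'. of_bool (D \<subseteq> E \<union> E')))
     = bern p D (\<lambda>E. bern p (A - D) (\<lambda>E'. of_bool (D \<subseteq> E)))"
    by (intro bern_cong arg_cong[where f = of_bool]) auto
  ultimately show ?thesis
    using assms by (simp add: Un_absorb1)
qed

text \<open>Marginalisation: the elements outside \<open>D\<close> integrate to 1. It reduces events
  of the whole graph to the edges inside an initial segment of the vertices and the edges from one
  vertex to it.\<close>

lemma bern_local:
  assumes "finite A" "D \<subseteq> A" "\<And>E. E \<subseteq> A \<Longrightarrow> f E = f (E \<inter> D)"
  shows "bern p A f = bern p D f"
proof -
  have fD: "finite D" using assms finite_subset by blast
  have "bern p (D \<union> (A - D)) f = bern p D (\<lambda>E. bern p (A - D) (\<lambda>E'. f (E \<union> E')))"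
    using assms fD by (intro bern_Un) auto
  moreover have "bern p D (\<lambda>E. bern p (A - D) (\<lambda>E'. f (E \<union> E'))) = bern p D (\<lambda>E. bern p (A - D) (\<lambda>E'. f E))"
  proof (intro bern_cong)
    fix E E' assume "E \<subseteq> D" "E' \<subseteq> A - D"
    then have "(E \<union> E') \<inter> D = E" "E \<union> E' \<subseteq> A"
      using assms(2) by auto
    then have "f (E \<union> E') = f E"
      using assms(3)[of "E \<union> E'"] by simp
    then show "f (E \<union> E') = f E" by simp
  qed
  ultimately show ?thesis
    using assms by (simp add: Un_absorb1)
qed

lemma bern_markov:
  assumes "0 \<le> p" "p \<le> 1" "0 < a" "\<And>E. E \<subseteq> A \<Longrightarrow> 0 \<le> f E"
  shows "bern p A (\<lambda>E. of_bool (a \<le> f E)) \<le> bern p A f / a"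
proof -
  have "bern p A (\<lambda>E. of_bool (a \<le> f E)) \<le> bern p A (\<lambda>E. (1 / a) * f E)"
    using assms by (intro bern_mono) (auto simp: field_simps)
  then show ?thesis by (simp only: bern_cmult) simp
qed

lemma finite_all_pairs [simp]: "finite (all_pairs n)"
proof -
  have "all_pairs n \<subseteq> Pow {1..n}" by (auto simp: all_pairs_def)
  then show ?thesis using finite_subset by blast
qed

lemma prob_Gnp_eq_bern: "prob_Gnp n p P = bern p (all_pairs n) (\<lambda>E. of_bool (P E))"
  unfolding prob_Gnp_def bern_def by (rule sum.cong) auto


section \<open>Chordal graphs\<close>

text \<open>On an induced cycle the largest vertex has two smaller neighbours, and the hypothesis
  supplies a chord between them. The natural order of the numbers thus serves as a perfect
  elimination ordering.\<close>

lemma chordal_if_ordered: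
  assumes ord: "\<And>v x y. {v, x} \<in> F \<Longrightarrow> {v, y} \<in> F \<Longrightarrow> x < v \<Longrightarrow> y < v \<Longrightarrow> x \<noteq> y \<Longrightarrow> {x, y} \<in> F"
  shows "chordal F"
  unfolding chordal_def
proof (rule notI, elim exE conjE)
  fix cs :: "nat list"
  assume len: "4 \<le> length cs" and dist: "distinct cs"
    and ind: "\<forall>i<length cs. \<forall>j<length cs. i \<noteq> j \<longrightarrow>
      ({cs ! i, cs ! j} \<in> F \<longleftrightarrow> (j = Suc i mod length cs \<or> i = Suc j mod length cs))"
  define L where "L = length cs"
  have L: "4 \<le> L" using len L_def by simp
  have "Max (set cs) \<in> set cs" using len by (intro Max_in) auto
  then obtain i where i: "i < L" "cs ! i = Max (set cs)"
    by (auto simp: in_set_conv_nth L_def)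
  define j where "j = Suc i mod L"
  define k where "k = (if i = 0 then L - 1 else i - 1)"
  have jlt: "j < L" and klt: "k < L" using L i by (auto simp: j_def k_def)
  have ki: "i = Suc k mod L" using L i by (auto simp: k_def)
  have jval: "j = (if i = L - 1 then 0 else Suc i)" using L i by (auto simp: j_def)
  \<comment> \<open>Length at least 4 enters here: in a triangle the predecessor \<open>k\<close> of
    \<open>i\<close> is the successor of its successor \<open>j\<close>, and the edge between them
    is no chord. The cases separate the positions where \<open>j\<close> or its successor wraps
    around.\<close>
  have ne: "j \<noteq> i" "k \<noteq> i" "j \<noteq> k" "k \<noteq> Suc j mod L"
  proof -
    consider "i = L - 1" | "i = L - 2" | "Suc (Suc i) < L" using i(1) by linarith
    then have "j \<noteq> i \<and> k \<noteq> i \<and> j \<noteq> k \<and> k \<noteq> Suc j mod L"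
    proof cases
      case 1
      then have "j = 0" "k = L - 2" using L jval by (auto simp: k_def)
      moreover have "Suc 0 mod L = 1" using L by simp
      ultimately show ?thesis using 1 L by (simp, arith)
    next
      case 2
      then have "j = L - 1" "k = L - 3" using L jval by (auto simp: k_def)
      moreover have "Suc (L - 1) mod L = 0" using L by simp
      moreover have "Suc j mod L = 0" using calculation by simp
      ultimately show ?thesis using 2 L by (intro conjI; simp; arith?)
    next
      case 3
      then have "j = Suc i" using jval by auto
      moreover have "Suc (Suc i) mod L = Suc (Suc i)" using 3 by simp
      ultimately show ?thesis using 3 L unfolding k_def by (cases "i = 0") auto
    qed
    then show "j \<noteq> i" "k \<noteq> i" "j \<noteq> k" "k \<noteq> Suc j mod L" by auto
  qed
  have lt: "cs ! l < cs ! i" if "l < L" "l \<noteq> i" for l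
  proof -
    have "cs ! l \<le> cs ! i" using that i by (simp add: L_def)
    moreover have "cs ! l \<noteq> cs ! i" using that i(1) dist by (simp add: L_def nth_eq_iff_index_eq)
    ultimately show ?thesis by simp
  qed
  have "{cs ! i, cs ! j} \<in> F" "{cs ! i, cs ! k} \<in> F"
    using ind i jlt klt ne ki by (auto simp: L_def j_def)
  moreover have "cs ! j \<noteq> cs ! k"
    using ne jlt klt dist by (simp add: L_def nth_eq_iff_index_eq)
  ultimately have "{cs ! j, cs ! k} \<in> F"
    using ord lt jlt klt ne by blast
  then have "k = Suc j mod L \<or> j = Suc k mod L"
    using ind jlt klt ne unfolding L_def by blast
  with ne ki show False by simp
qed

section \<open>Induced paths and simplicial vertices of chordal graphs\<close>

definition induced_path :: "'a set set \<Rightarrow> 'a list \<Rightarrow> bool" where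
  "induced_path F ps \<longleftrightarrow> distinct ps \<and>
     (\<forall>i j. i < j \<longrightarrow> j < length ps \<longrightarrow> ({ps ! i, ps ! j} \<in> F \<longleftrightarrow> j = Suc i))"

lemma induced_path_singleton [simp]: "induced_path F [x]"
  by (simp add: induced_path_def)

lemma induced_path_drop: "induced_path F ps \<Longrightarrow> induced_path F (drop k ps)"
  by (auto simp: induced_path_def)

lemma induced_path_rev:
  assumes "induced_path F ps"
  shows "induced_path F (rev ps)"
  unfolding induced_path_def
proof (intro conjI allI impI)
  show "distinct (rev ps)" using assms by (simp add: induced_path_def)
next
  fix i j assume ij: "i < j" "j < length (rev ps)"
  let ?n = "length ps"
  have "?n - Suc j < ?n - Suc i" "?n - Suc i < ?n" using ij by auto
  then have "{ps ! (?n - Suc j), ps ! (?n - Suc i)} \<in> F \<longleftrightarrow> ?n - Suc i = Suc (?n - Suc j)"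
    using assms unfolding induced_path_def by blast
  then show "{rev ps ! i, rev ps ! j} \<in> F \<longleftrightarrow> j = Suc i"
    using ij by (auto simp: rev_nth insert_commute)
qed

lemma induced_path_Cons:
  "induced_path F (z # qs) \<longleftrightarrow> z \<notin> set qs \<and> induced_path F qs \<and>
     (\<forall>j<length qs. {z, qs ! j} \<in> F \<longleftrightarrow> j = 0)"
proof -
  have "(\<forall>i j. i < j \<longrightarrow> j < length (z # qs) \<longrightarrow> ({(z # qs) ! i, (z # qs) ! j} \<in> F \<longleftrightarrow> j = Suc i))
    \<longleftrightarrow> (\<forall>j<length qs. {z, qs ! j} \<in> F \<longleftrightarrow> j = 0) \<and>
      (\<forall>i j. i < j \<longrightarrow> j < length qs \<longrightarrow> ({qs ! i, qs ! j} \<in> F \<longleftrightarrow> j = Suc i))" (is "?l \<longleftrightarrow> ?r")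
  proof
    assume l: ?l
    show ?r
    proof (intro conjI allI impI)
      fix j assume "j < length qs" then show "{z, qs ! j} \<in> F \<longleftrightarrow> j = 0"
        using l[rule_format, of 0 "Suc j"] by simp
    next
      fix i j assume "i < j" "j < length qs" then show "{qs ! i, qs ! j} \<in> F \<longleftrightarrow> j = Suc i"
        using l[rule_format, of "Suc i" "Suc j"] by simp
    qed
  next
    assume r: ?r
    show ?l
    proof (intro allI impI)
      fix i j assume ij: "i < j" "j < length (z # qs)"
      then obtain j' where j': "j = Suc j'" by (cases j) auto
      show "{(z # qs) ! i, (z # qs) ! j} \<in> F \<longleftrightarrow> j = Suc i"
        using r ij j' by (cases i) auto
    qed
  qed
  then show ?thesis by (auto simp: induced_path_def)
qed

text \<open>A shortcut: \<open>z\<close> enters the path at its last neighbour there, so no later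
  vertex of the path is adjacent to \<open>z\<close> and the new path is again induced.\<close>

lemma induced_path_extend:
  assumes "induced_path F ps" "ps \<noteq> []" "{z, hd ps} \<in> F" "z \<notin> set ps"
  obtains qs where "qs \<noteq> []" "induced_path F (z # qs)" "last qs = last ps" "set qs \<subseteq> set ps"
proof -
  define I where "I = {i. i < length ps \<and> {z, ps ! i} \<in> F}"
  have fI: "finite I" by (simp add: I_def)
  have "0 \<in> I" using assms by (simp add: I_def hd_conv_nth)
  then have m: "Max I \<in> I" using fI by (intro Max_in) auto
  define k where "k = Max I"
  have k: "k < length ps" "{z, ps ! k} \<in> F" using m by (auto simp: k_def I_def)
  have big: "{z, ps ! (k + j)} \<in> F \<longleftrightarrow> j = 0" if "j < length (drop k ps)" for j
  proof
    assume "{z, ps ! (k + j)} \<in> F"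
    then have "k + j \<in> I" using that by (simp add: I_def)
    then have "k + j \<le> k" using fI unfolding k_def by (rule Max_ge[rotated])
    then show "j = 0" by simp
  qed (use k in simp)
  show thesis
  proof
    show "drop k ps \<noteq> []" using k by simp
    show "last (drop k ps) = last ps" using k by simp
    show "set (drop k ps) \<subseteq> set ps" by (rule set_drop_subset)
    show "induced_path F (z # drop k ps)"
      unfolding induced_path_Cons
      using assms big induced_path_drop by (auto dest: in_set_dropD)
  qed
qed

text \<open>Connectedness as growth by one adjacent vertex at a time, which provides the induction
  that builds induced paths inside the set.\<close>

inductive connected_set :: "'a set set \<Rightarrow> 'a set \<Rightarrow> bool" for F where
  single: "connected_set F {u}"
| insert: "connected_set F U \<Longrightarrow> u \<in> U \<Longrightarrow> {u, y} \<in> F \<Longrightarrow> y \<notin> U \<Longrightarrow> connected_set F (insert y U)"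

lemma connected_set_induced_path:
  assumes "connected_set F U" "a \<in> U" "b \<in> U"
  shows "\<exists>ps. ps \<noteq> [] \<and> induced_path F ps \<and> hd ps = a \<and> last ps = b \<and> set ps \<subseteq> U"
  using assms
proof (induction arbitrary: a b)
  case (single u)
  then show ?case by (intro exI[of _ "[u]"]) auto
next
  case (insert U u y)
  have from_y: "\<exists>ps. ps \<noteq> [] \<and> induced_path F ps \<and> hd ps = y \<and> last ps = c \<and> set ps \<subseteq> insert y U"
    if c: "c \<in> U" for c
  proof -
    obtain ps where ps: "ps \<noteq> []" "induced_path F ps" "hd ps = u" "last ps = c" "set ps \<subseteq> U"
      using insert.IH insert.hyps c by blast
    have "{y, hd ps} \<in> F" "y \<notin> set ps"
      using ps insert.hyps by (auto simp: insert_commute)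
    then obtain qs where "qs \<noteq> []" "induced_path F (y # qs)" "last qs = last ps" "set qs \<subseteq> set ps"
      using induced_path_extend ps by metis
    then show ?thesis
      using ps by (intro exI[of _ "y # qs"]) auto
  qed
  consider "a = y" "b = y" | "a = y" "b \<in> U" | "a \<in> U" "b = y" | "a \<in> U" "b \<in> U"
    using insert.prems by blast
  then show ?case
  proof cases
    case 1
    then show ?thesis by (intro exI[of _ "[y]"]) auto
  next
    case 2
    then show ?thesis using from_y by blast
  next
    case 3
    then obtain ps where "ps \<noteq> []" "induced_path F ps" "hd ps = y" "last ps = a" "set ps \<subseteq> insert y U"
      using from_y by blast
    then show ?thesis
      using 3 by (intro exI[of _ "rev ps"]) (auto simp: hd_rev last_rev induced_path_rev)
  next
    case 4
    then show ?thesis using insert.IH[of a b] by blast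
  qed
qed

text \<open>The vertex \<open>w\<close> closes the path to an induced cycle with one vertex more,
  hence of length at least 4.\<close>

lemma chordal_no_induced_cycle:
  assumes ch: "chordal F" and ps: "induced_path F ps" "3 \<le> length ps"
    and w: "w \<notin> set ps" "\<And>j. j < length ps \<Longrightarrow> {w, ps ! j} \<in> F \<longleftrightarrow> j = 0 \<or> Suc j = length ps"
  shows False
proof -
  define L where "L = length ps"
  have L: "3 \<le> L" using ps by (simp add: L_def)
  have key: "{(w # ps) ! i, (w # ps) ! j} \<in> F \<longleftrightarrow> (j = Suc i mod Suc L \<or> i = Suc j mod Suc L)"
    if ij: "i < j" "j < Suc L" for i j
  proof -
    obtain j' where j': "j = Suc j'" using ij by (cases j) auto
    have m1: "Suc i mod Suc L = Suc i" using ij by simp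
    have m2: "Suc j mod Suc L = (if j' = L - 1 then 0 else Suc j)" using ij j' L by auto
    show ?thesis
    proof (cases i)
      case 0
      then show ?thesis using w(2)[of j'] ij j' L m2 by (auto simp: L_def)
    next
      case (Suc i')
      have "{ps ! i', ps ! j'} \<in> F \<longleftrightarrow> j' = Suc i'"
        using ps ij j' Suc by (auto simp: induced_path_def L_def)
      then show ?thesis using Suc j' m1 m2 ij by auto
    qed
  qed
  have "{(w # ps) ! i, (w # ps) ! j} \<in> F \<longleftrightarrow> (j = Suc i mod Suc L \<or> i = Suc j mod Suc L)"
    if "i \<noteq> j" "j < Suc L" "i < Suc L" for i j
    using key[of i j] key[of j i] that by (cases "i < j") (auto simp: insert_commute)
  then show False
    using ch ps w(1) L unfolding chordal_def
    by (auto simp: L_def induced_path_def dest!: spec[of _ "w # ps"])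
qed

definition simplicial :: "'a set set \<Rightarrow> 'a set \<Rightarrow> 'a \<Rightarrow> bool" where
  "simplicial F V s \<longleftrightarrow> (\<forall>x\<in>V. \<forall>y\<in>V. x \<noteq> s \<longrightarrow> y \<noteq> s \<longrightarrow> x \<noteq> y \<longrightarrow>
     {s, x} \<in> F \<longrightarrow> {s, y} \<in> F \<longrightarrow> {x, y} \<in> F)"

text \<open>Dirac's theorem. Let \<open>U\<close> be a maximal connected set that does not dominate the graph, \<open>N\<close> its
  neighbourhood and \<open>W \<noteq> {}\<close> the rest. By maximality \<open>N\<close> is complete to \<open>W\<close>, so two nonadjacent
  vertices of \<open>N\<close> would give an induced cycle through \<open>U\<close> and a vertex of \<open>W\<close>. Hence \<open>N\<close> is a
  clique, and a vertex simplicial in \<open>W\<close> is simplicial.\<close>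
lemma chordal_simplicial:
  assumes ch: "chordal F" and "finite V" "V \<noteq> {}"
  shows "\<exists>s\<in>V. simplicial F V s"
  using assms(2,3)
proof (induction "card V" arbitrary: V rule: less_induct)
  case less
  define N where "N U = {y \<in> V - U. \<exists>u\<in>U. {u, y} \<in> F}" for U
  define good where "good U \<longleftrightarrow> U \<subseteq> V \<and> connected_set F U \<and> V - U - N U \<noteq> {}" for U
  show ?case
  proof (cases "\<exists>u\<in>V. \<exists>w\<in>V. u \<noteq> w \<and> {u, w} \<notin> F")
    case False
    then show ?thesis using less.prems unfolding simplicial_def by blast
  next
    case True
    then obtain u0 w0 where "u0 \<in> V" "w0 \<in> V" "u0 \<noteq> w0" "{u0, w0} \<notin> F" by blast
    then have "good {u0}" by (auto simp: good_def N_def connected_set.single)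
    moreover have "\<forall>U. good U \<longrightarrow> card U < Suc (card V)"
      using less.prems by (auto simp: good_def less_Suc_eq_le intro: card_mono)
    ultimately obtain U where U: "good U" and max: "\<And>U'. good U' \<Longrightarrow> card U' \<le> card U"
      using ex_has_greatest_nat[of good "{u0}" card "Suc (card V)"] by metis
    have UV: "U \<subseteq> V" and cU: "connected_set F U" using U by (auto simp: good_def)
    have fU: "finite U" using UV less.prems finite_subset by blast
    define W where "W = V - U - N U"
    have W: "W \<noteq> {}" "W \<subseteq> V" using U by (auto simp: good_def W_def)
    have complete: "{y, w} \<in> F" if y: "y \<in> N U" and w: "w \<in> W" for y w
    proof (rule ccontr)
      assume nF: "{y, w} \<notin> F"
      obtain u where u: "u \<in> U" "{u, y} \<in> F" "y \<in> V" "y \<notin> U" using y by (auto simp: N_def)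
      have "connected_set F (insert y U)" using cU u by (auto intro: connected_set.insert)
      \<comment> \<open>Not being adjacent to \<open>y\<close>, the vertex \<open>w\<close> stays
        outside the enlarged set and its neighbourhood.\<close>
      moreover have "w \<in> V - insert y U - N (insert y U)"
        using w nF y by (auto simp: W_def N_def)
      ultimately have "good (insert y U)" using UV u by (auto simp: good_def)
      then have "card (insert y U) \<le> card U" by (rule max)
      then show False using fU u by simp
    qed
    have clique: "{x, y} \<in> F" if x: "x \<in> N U" and y: "y \<in> N U" and xy: "x \<noteq> y" for x y
    proof (rule ccontr)
      assume nF: "{x, y} \<notin> F"
      obtain w where w: "w \<in> W" using W by blast
      obtain ux where ux: "ux \<in> U" "{ux, x} \<in> F" "x \<notin> U" using x by (auto simp: N_def)
      obtain uy where uy: "uy \<in> U" "{uy, y} \<in> F" "y \<notin> U" using y by (auto simp: N_def)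
      have "connected_set F (insert x U)" using cU ux by (auto intro: connected_set.insert)
      then have "connected_set F (insert y (insert x U))"
        using uy xy connected_set.insert[of F "insert x U" uy y] by auto
      then obtain ps where ps: "ps \<noteq> []" "induced_path F ps" "hd ps = x" "last ps = y"
        "set ps \<subseteq> insert y (insert x U)"
        using connected_set_induced_path[of F _ x y] by blast
      have d: "distinct ps" using ps by (simp add: induced_path_def)
      have hd0: "ps ! 0 = x" and lst: "ps ! (length ps - 1) = y"
        using ps by (auto simp: hd_conv_nth last_conv_nth)
      have l3: "3 \<le> length ps"
      proof (rule ccontr)
        assume "\<not> 3 \<le> length ps"
        then consider "length ps = 1" | "length ps = 2"
          using ps(1) length_greater_0_conv[of ps] by linarith
        then show False
        proof cases
          case 1 then show False using hd0 lst xy by auto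
        next
          case 2
          then have "{ps ! 0, ps ! 1} \<in> F" using ps(2) by (auto simp: induced_path_def)
          then show False using 2 hd0 lst nF by auto
        qed
      qed
      have "w \<notin> set ps" using w ps(5) x y by (auto simp: W_def)
      moreover have "{w, ps ! j} \<in> F \<longleftrightarrow> j = 0 \<or> Suc j = length ps" if j: "j < length ps" for j
      proof
        assume "j = 0 \<or> Suc j = length ps"
        then have "j = 0 \<or> j = length ps - 1" by linarith
        then have "ps ! j = x \<or> ps ! j = y" using hd0 lst by blast
        then show "{w, ps ! j} \<in> F"
          using complete[OF x w] complete[OF y w] by (auto simp: insert_commute[of w])
      next
        assume a: "{w, ps ! j} \<in> F"
        \<comment> \<open>All vertices of the path other than \<open>x\<close> and \<open>y\<close>
          lie in \<open>U\<close>, where \<open>w\<close> has no neighbour.\<close>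
        have "ps ! j \<notin> U" using a w by (auto simp: W_def N_def insert_commute)
        then have "ps ! j = x \<or> ps ! j = y" using ps(5) j nth_mem by blast
        then show "j = 0 \<or> Suc j = length ps"
          using hd0 lst d j ps(1) by (metis Suc_diff_1 diff_less length_greater_0_conv nth_eq_iff_index_eq zero_less_one)
      qed
      ultimately show False using chordal_no_induced_cycle[OF ch ps(2) l3] by blast
    qed
    have "U \<noteq> {}" using cU by cases auto
    then have "W \<subset> V" using UV by (auto simp: W_def)
    then have "card W < card V" "finite W" using less.prems by (auto intro: psubset_card_mono finite_subset)
    then obtain s where s: "s \<in> W" "simplicial F W s" using less.hyps W by blast
    have nb: "x \<in> W \<or> x \<in> N U" if "x \<in> V" "{s, x} \<in> F" for x
      using that s(1) by (auto simp: W_def N_def insert_commute)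
    have "simplicial F V s"
      unfolding simplicial_def
    proof (intro ballI impI)
      fix x y assume *: "x \<in> V" "y \<in> V" "x \<noteq> s" "y \<noteq> s" "x \<noteq> y" "{s, x} \<in> F" "{s, y} \<in> F"
      then consider "x \<in> W" "y \<in> W" | "x \<in> W" "y \<in> N U" | "x \<in> N U" "y \<in> W" | "x \<in> N U" "y \<in> N U"
        using nb by blast
      then show "{x, y} \<in> F"
      proof cases
        case 1
        then show ?thesis using s(2) * by (auto simp: simplicial_def)
      next
        case 2
        then show ?thesis using complete[of y x] by (simp add: insert_commute)
      qed (use complete clique * in auto)
    qed
    then show ?thesis using s(1) W(2) by blast
  qed
qed


section \<open>Back-neighbourhoods along a forest\<close>

definition pairs :: "'a set \<Rightarrow> 'a set set" where
  "pairs V = {e. \<exists>i j. i \<in> V \<and> j \<in> V \<and> i \<noteq> j \<and> e = {i, j}}"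

definition clique :: "'a set set \<Rightarrow> 'a set \<Rightarrow> bool" where
  "clique E C \<longleftrightarrow> (\<forall>x\<in>C. \<forall>y\<in>C. x \<noteq> y \<longrightarrow> {x, y} \<in> E)"

lemma all_pairs_eq: "all_pairs n = pairs {1..n}"
  by (simp add: all_pairs_def pairs_def)

lemma finite_pairs [simp]: "finite V \<Longrightarrow> finite (pairs V)"
  by (rule finite_subset[of _ "Pow V"]) (auto simp: pairs_def)

lemma pairs_mono: "U \<subseteq> V \<Longrightarrow> pairs U \<subseteq> pairs V"
  unfolding pairs_def by blast

lemma pairs_insert: "v \<notin> U \<Longrightarrow> pairs (insert v U) = pairs U \<union> (\<lambda>w. {v, w}) ` U"
  unfolding pairs_def by auto

lemma doubleton_in_pairs [simp]: "{v, w} \<in> pairs U \<longleftrightarrow> v \<in> U \<and> w \<in> U \<and> v \<noteq> w"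
  by (auto simp: pairs_def doubleton_eq_iff)

lemma singleton_notin_pairs [simp]: "{v} \<notin> pairs U"
  by (auto simp: pairs_def)

lemma pairs_Un_star_disjoint: "v \<notin> U \<Longrightarrow> pairs U \<inter> (\<lambda>w. {v, w}) ` U = {}"
  by auto

lemma inj_on_star: "inj_on (\<lambda>w. {v, w}) A"
  by (auto simp: inj_on_def doubleton_eq_iff)

lemma card_pairs: "finite V \<Longrightarrow> card (pairs V) = card V choose 2"
proof (induction V rule: finite_induct)
  case empty
  then show ?case by (simp add: pairs_def)
next
  case (insert v V)
  then show ?case
    by (simp add: pairs_insert card_Un_disjoint pairs_Un_star_disjoint card_image inj_on_star
        numeral_2_eq_2)
qed

lemma clique_iff_pairs: "clique E C \<longleftrightarrow> pairs C \<subseteq> E"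
  unfolding clique_def pairs_def by blast

section \<open>Back neighbours along a parent function\<close>

text \<open>If the earlier neighbours of \<open>v\<close> form a clique with last element
  \<open>\<pi> v\<close>, all others are earlier neighbours of \<open>\<pi> v\<close>. The rules
  turn this property into a recursion that makes sense for every \<open>E\<close> and \<pi>, so that
  \<open>E\<close> can be random while \<pi> is fixed.\<close>

inductive back_nbr :: "'a set set \<Rightarrow> ('a \<Rightarrow> 'a) \<Rightarrow> 'a \<Rightarrow> 'a \<Rightarrow> bool" for E \<pi> where
  parent: "{v, \<pi> v} \<in> E \<Longrightarrow> back_nbr E \<pi> v (\<pi> v)"
| ancestor: "back_nbr E \<pi> (\<pi> v) w \<Longrightarrow> {v, w} \<in> E \<Longrightarrow> back_nbr E \<pi> v w"

definition bk :: "'a set set \<Rightarrow> ('a \<Rightarrow> 'a) \<Rightarrow> 'a \<Rightarrow> 'a set" where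
  "bk E \<pi> v = {w. back_nbr E \<pi> v w}"

text \<open>Only the existence of an order is recorded in which each vertex comes after its parent.
  A root is encoded by \<open>\<pi> v = v\<close>, which keeps \<pi> a map of the vertex set into
  itself.\<close>

inductive forest :: "('a \<Rightarrow> 'a) \<Rightarrow> 'a set \<Rightarrow> bool" for \<pi> where
  empty: "forest \<pi> {}"
| insert: "forest \<pi> U \<Longrightarrow> v \<notin> U \<Longrightarrow> \<pi> v \<in> insert v U \<Longrightarrow> forest \<pi> (insert v U)"

lemma bk_rec: "bk E \<pi> v = {w \<in> insert (\<pi> v) (bk E \<pi> (\<pi> v)). {v, w} \<in> E}"
  unfolding bk_def by (auto elim: back_nbr.cases intro: back_nbr.intros)

lemma bk_mono:
  assumes "E \<subseteq> E'" shows "bk E \<pi> v \<subseteq> bk E' \<pi> v"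
proof -
  have "back_nbr E \<pi> v w \<Longrightarrow> back_nbr E' \<pi> v w" for w
    by (induction rule: back_nbr.induct) (use assms in \<open>auto intro: back_nbr.intros\<close>)
  then show ?thesis by (auto simp: bk_def)
qed

text \<open>At a root the recursion for \<open>bk\<close> refers to itself; the inductive definition
  selects the least solution, which is empty when there is no loop at \<open>v\<close>.\<close>

lemma bk_root:
  assumes "\<pi> v = v" "{v} \<notin> E" shows "bk E \<pi> v = {}"
proof -
  have "back_nbr E \<pi> v w \<Longrightarrow> \<pi> v = v \<Longrightarrow> {v} \<notin> E \<Longrightarrow> False" for w
    by (induction rule: back_nbr.induct) auto
  then show ?thesis using assms by (auto simp: bk_def)
qed

lemma back_nbr_edge: "back_nbr E \<pi> v w \<Longrightarrow> {v, w} \<in> E"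
  by (erule back_nbr.cases) auto

text \<open>Of two back neighbours of \<open>v\<close>, either one is \<open>\<pi> v\<close> and the
  other a back neighbour of it, hence adjacent to it, or both are back neighbours of
  \<open>\<pi> v\<close> and induction applies.\<close>

lemma clique_insert_bk: "clique E (insert v (bk E \<pi> v))"
proof -
  have "back_nbr E \<pi> v w \<Longrightarrow> back_nbr E \<pi> v w' \<Longrightarrow> w \<noteq> w' \<Longrightarrow> {w, w'} \<in> E" for w w'
  proof (induction arbitrary: w' rule: back_nbr.induct)
    case (parent v)
    from parent(2,3) show ?case
      by cases (auto dest: back_nbr_edge)
  next
    case (ancestor v w)
    from ancestor.prems(1) show ?case
    proof cases
      case parent
      then show ?thesis using ancestor.hyps back_nbr_edge[of E \<pi> "\<pi> v" w] by (simp add: insert_commute)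
    next
      case ancestor
      then show ?thesis using ancestor.IH ancestor.prems by blast
    qed
  qed
  then show ?thesis
    unfolding clique_def bk_def by (auto dest: back_nbr_edge simp: insert_commute)
qed

lemma forest_closed: "forest \<pi> U \<Longrightarrow> v \<in> U \<Longrightarrow> \<pi> v \<in> U"
  by (induction rule: forest.induct) auto

lemma forest_cong: "forest \<pi> U \<Longrightarrow> (\<And>v. v \<in> U \<Longrightarrow> \<pi>' v = \<pi> v) \<Longrightarrow> forest \<pi>' U"
  by (induction rule: forest.induct) (auto intro!: forest.intros)

lemma forest_finite: "forest \<pi> U \<Longrightarrow> finite U"
  by (induction rule: forest.induct) auto

lemma bk_subset:
  assumes "\<And>v. v \<in> U \<Longrightarrow> \<pi> v \<in> U" "v \<in> U" shows "bk E \<pi> v \<subseteq> U"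
proof -
  have "back_nbr E \<pi> v w \<Longrightarrow> v \<in> U \<Longrightarrow> w \<in> U" for w
    by (induction rule: back_nbr.induct) (use assms in auto)
  then show ?thesis using assms by (auto simp: bk_def)
qed

text \<open>Back neighbours are found by following parents and never leave a set closed under \<pi>.
  Adding a new vertex, with its edges and its parent, therefore does not disturb the old back
  neighbourhoods.\<close>

lemma bk_cong:
  assumes cl: "\<And>v. v \<in> U \<Longrightarrow> \<pi> v \<in> U" and "v \<in> U"
    and eq: "\<And>v. v \<in> U \<Longrightarrow> \<pi>' v = \<pi> v"
    and E: "\<And>v w. v \<in> U \<Longrightarrow> w \<in> U \<Longrightarrow> {v, w} \<in> E' \<longleftrightarrow> {v, w} \<in> E"
  shows "bk E' \<pi>' v = bk E \<pi> v"
proof -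
  have "back_nbr E \<pi> v w \<Longrightarrow> v \<in> U \<Longrightarrow> w \<in> U \<and> back_nbr E' \<pi>' v w" for v w
  proof (induction rule: back_nbr.induct)
    case (parent v)
    then show ?case using cl[of v] eq[of v] E[of v "\<pi> v"] back_nbr.parent[of v \<pi>' E'] by auto
  next
    case (ancestor v w)
    then show ?case using cl[of v] eq[of v] E[of v w] back_nbr.ancestor[of E' \<pi>' v w] by auto
  qed
  moreover have "back_nbr E' \<pi>' v w \<Longrightarrow> v \<in> U \<Longrightarrow> w \<in> U \<and> back_nbr E \<pi> v w" for v w
  proof (induction rule: back_nbr.induct)
    case (parent v)
    then show ?case using cl[of v] eq[of v] E[of v "\<pi> v"] back_nbr.parent[of v \<pi> E] by auto
  next
    case (ancestor v w)
    then show ?case using cl[of v] eq[of v] E[of v w] back_nbr.ancestor[of E \<pi> v w] by auto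
  qed
  ultimately show ?thesis using \<open>v \<in> U\<close> by (auto simp: bk_def)
qed

lemma card_bk_less:
  assumes "E \<subseteq> pairs V" "\<And>v. v \<in> V \<Longrightarrow> \<pi> v \<in> V" "v \<in> V" "finite V"
    and noclique: "\<And>C. C \<subseteq> V \<Longrightarrow> card C = Suc S \<Longrightarrow> \<not> clique E C"
  shows "card (bk E \<pi> v) < S"
proof (rule ccontr)
  assume ge: "\<not> card (bk E \<pi> v) < S"
  have sub: "bk E \<pi> v \<subseteq> V" using assms(2,3) by (rule bk_subset)
  then have fin: "finite (bk E \<pi> v)" using assms(4) finite_subset by blast
  have "v \<notin> bk E \<pi> v"
    using assms(1) back_nbr_edge[of E \<pi> v v] by (auto simp: bk_def)
  then have "Suc S \<le> card (insert v (bk E \<pi> v))"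
    using fin ge by simp
  then obtain C where C: "C \<subseteq> insert v (bk E \<pi> v)" "card C = Suc S"
    by (meson obtain_subset_with_card_n)
  then have "clique E C"
    using clique_insert_bk[of E v \<pi>] unfolding clique_def by blast
  then show False using noclique[of C] C sub assms(3) by blast
qed

text \<open>A perfect elimination ordering, recorded only through the function sending each vertex to the
  last of its earlier neighbours.\<close>
lemma chordal_forest:
  fixes F :: "nat set set"
  assumes ch: "chordal F" and F: "F \<subseteq> pairs X" and "finite V"
  shows "\<exists>\<pi>. forest \<pi> V \<and>
    (\<forall>C\<subseteq>V. C \<noteq> {} \<longrightarrow> clique F C \<longrightarrow> (\<exists>c\<in>C. C \<subseteq> insert c (bk F \<pi> c))) \<and>
    card (F \<inter> pairs V) \<le> (\<Sum>v\<in>V. card (bk F \<pi> v))"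
  using assms(3)
proof (induction "card V" arbitrary: V)
  case 0
  then show ?case by (auto intro: forest.empty simp: pairs_def)
next
  case (Suc n)
  then have "V \<noteq> {}" by auto
  then obtain s where s: "s \<in> V" "simplicial F V s"
    using chordal_simplicial[OF ch] Suc.prems by blast
  define U where "U = V - {s}"
  have V: "V = insert s U" "s \<notin> U" "finite U" and cU: "card U = n"
    using s Suc by (auto simp: U_def)
  obtain \<pi> where \<pi>: "forest \<pi> U"
    and cl: "\<And>C. C \<subseteq> U \<Longrightarrow> C \<noteq> {} \<Longrightarrow> clique F C \<Longrightarrow> \<exists>c\<in>C. C \<subseteq> insert c (bk F \<pi> c)"
    and le: "card (F \<inter> pairs U) \<le> (\<Sum>v\<in>U. card (bk F \<pi> v))"
    using Suc.hyps(1)[OF cU[symmetric] V(3)] by blast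
  define B where "B = {w \<in> U. {s, w} \<in> F}"
  have nl: "{v} \<notin> F" for v using F by auto
  have "clique F B"
    using s(2) V(2) unfolding simplicial_def clique_def B_def V(1) by (simp, metis)
  \<comment> \<open>The clause on cliques was put into the induction for this step: \<open>c\<close>
    is in effect the last vertex of the clique \<open>B\<close> of neighbours of \<open>s\<close>,
    and it becomes the parent of \<open>s\<close>.\<close>
  have "\<exists>c. c \<in> B \<and> B \<subseteq> insert c (bk F \<pi> c)" if "B \<noteq> {}"
    using cl[of B] that \<open>clique F B\<close> unfolding B_def by blast
  \<comment> \<open>Without earlier neighbours \<open>s\<close> becomes a root, that is, its own
    parent.\<close>
  then obtain c where c0: "B = {} \<Longrightarrow> c = s"
    and c: "B \<noteq> {} \<Longrightarrow> c \<in> B \<and> B \<subseteq> insert c (bk F \<pi> c)"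
    by metis
  define \<pi>' where "\<pi>' = \<pi>(s := c)"
  have "c \<in> insert s U" using c0 c by (cases "B = {}") (auto simp: B_def)
  have "forest \<pi>' U" using \<pi> by (rule forest_cong) (use V in \<open>auto simp: \<pi>'_def\<close>)
  then have forest': "forest \<pi>' V"
    unfolding V(1) by (rule forest.insert) (use V \<open>c \<in> insert s U\<close> in \<open>auto simp: \<pi>'_def\<close>)
  have same: "bk F \<pi>' v = bk F \<pi> v" if "v \<in> U" for v
    using that forest_closed[OF \<pi>] V by (intro bk_cong[of U]) (auto simp: \<pi>'_def)
  have Bsub: "B \<subseteq> bk F \<pi>' s"
  proof (cases "B = {}")
    case False
    have "c \<in> U" using c False by (auto simp: B_def)
    have "bk F \<pi>' s = {w \<in> insert c (bk F \<pi> c). {s, w} \<in> F}"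
      by (subst bk_rec) (simp add: \<pi>'_def[THEN fun_cong, of s] same[OF \<open>c \<in> U\<close>])
    then show ?thesis using c False by (auto simp: B_def)
  qed simp
  show ?case
  proof (intro exI[of _ \<pi>'] conjI allI impI)
    show "forest \<pi>' V" by (fact forest')
  next
    fix C assume C: "C \<subseteq> V" "C \<noteq> {}" "clique F C"
    show "\<exists>c\<in>C. C \<subseteq> insert c (bk F \<pi>' c)"
    proof (cases "s \<in> C")
      case True
      have "C \<subseteq> insert s B"
      proof
        fix x assume x: "x \<in> C"
        show "x \<in> insert s B"
        proof (cases "x = s")
          case False
          then have "{s, x} \<in> F" using C(3) x True False unfolding clique_def by auto
          then show ?thesis using False x C(1) V(1) by (auto simp: B_def)
        qed simp
      qed
      then show ?thesis using True Bsub by (intro bexI[of _ s]) auto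
    next
      case False
      then have "C \<subseteq> U" using C V by blast
      then show ?thesis using cl[of C] C same by blast
    qed
  next
    have "F \<inter> pairs V = (F \<inter> pairs U) \<union> (\<lambda>w. {s, w}) ` B"
      unfolding V(1) pairs_insert[OF V(2)] B_def by blast
    then have "card (F \<inter> pairs V) \<le> card (F \<inter> pairs U) + card ((\<lambda>w. {s, w}) ` B)"
      by (simp add: card_Un_le)
    also have "card ((\<lambda>w. {s, w}) ` B) = card B" by (simp add: card_image inj_on_star)
    also have "card B \<le> card (bk F \<pi>' s)"
    proof (rule card_mono[OF _ Bsub])
      have "bk F \<pi>' s \<subseteq> V" using forest_closed[OF forest'] s(1) by (intro bk_subset) auto
      then show "finite (bk F \<pi>' s)" using Suc.prems finite_subset by blast
    qed
    also have "card (F \<inter> pairs U) \<le> (\<Sum>v\<in>U. card (bk F \<pi>' v))"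
      using le same by simp
    finally show "card (F \<inter> pairs V) \<le> (\<Sum>v\<in>V. card (bk F \<pi>' v))"
      using V by simp
  qed
qed

section \<open>Moment bounds for chordal subgraphs and for cliques\<close>

text \<open>The vertices are exposed in forest order. Given the edges among the old vertices, the
  candidates for back neighbours of \<open>v\<close> form a fixed set, so the conditional moment is
  the generating function of a binomial variable. The indicator limits the number of candidates,
  hence of trials, to \<open>S\<close>.\<close>

lemma forest_moment_le:
  assumes \<pi>: "forest \<pi> U" and p: "0 \<le> p" "p \<le> 1" and t: "1 \<le> t"
  shows "bern p (pairs U) (\<lambda>E. of_bool (\<forall>v\<in>U. card (bk E \<pi> v) < S) * t ^ (\<Sum>v\<in>U. card (bk E \<pi> v)))
    \<le> ((1 - p + p * t) ^ S) ^ card U"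
  using \<pi>
proof (induction rule: forest.induct)
  case empty
  then show ?case by (simp add: pairs_def)
next
  case (insert U v)
  define c where "c = 1 - p + p * t"
  have "p * 1 \<le> p * t" using p t by (intro mult_left_mono) auto
  then have c: "1 \<le> c" by (simp add: c_def)
  have fU: "finite U" using insert.hyps forest_finite by blast
  define star where "star = (\<lambda>w. {v, w}) ` U"
  define g where "g V E = of_bool (\<forall>v\<in>V. card (bk E \<pi> v) < S) * t ^ (\<Sum>v\<in>V. card (bk E \<pi> v))" for V E
  have g0: "0 \<le> g V E" for V E using t by (simp add: g_def)
  have step: "bern p star (\<lambda>D. g (insert v U) (E \<union> D)) \<le> c ^ S * g U E" if E: "E \<subseteq> pairs U" for E
  proof -
    define B where "B = (if \<pi> v = v then {} else insert (\<pi> v) (bk E \<pi> (\<pi> v)))"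
    have BU: "B \<subseteq> U"
      using insert.hyps bk_subset[of U \<pi> "\<pi> v" E] forest_closed[OF insert.hyps(1)]
      by (auto simp: B_def)
    have same: "bk (E \<union> D) \<pi> u = bk E \<pi> u" if "u \<in> U" "D \<subseteq> star" for u D
      using that forest_closed[OF insert.hyps(1)] insert.hyps(2)
      by (intro bk_cong[of U]) (auto simp: star_def doubleton_eq_iff)
    have new: "bk (E \<union> D) \<pi> v = {w \<in> B. {v, w} \<in> D}" if D: "D \<subseteq> star" for D
    proof (cases "\<pi> v = v")
      case True
      have "{v} \<notin> E \<union> D" using E D insert.hyps(2) by (auto simp: star_def)
      then show ?thesis using bk_root[of \<pi> v "E \<union> D"] True by (simp add: B_def)
    next
      case False
      then have "\<pi> v \<in> U" using insert.hyps by auto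
      have "{v, w} \<notin> E" for w using E insert.hyps(2) by auto
      then show ?thesis
        by (subst bk_rec) (use same[OF \<open>\<pi> v \<in> U\<close> D] False in \<open>simp add: B_def\<close>)
    qed
    have card_new: "card (bk (E \<union> D) \<pi> v) = card (D \<inter> (\<lambda>w. {v, w}) ` B)" if D: "D \<subseteq> star" for D
    proof -
      have "D \<inter> (\<lambda>w. {v, w}) ` B = (\<lambda>w. {v, w}) ` {w \<in> B. {v, w} \<in> D}" by auto
      then show ?thesis using new[OF D] by (simp add: card_image inj_on_star)
    qed
    have "bern p star (\<lambda>D. g (insert v U) (E \<union> D))
      \<le> bern p star (\<lambda>D. g U E * t ^ card (D \<inter> (\<lambda>w. {v, w}) ` B))"
    proof (rule bern_mono[OF p])
      fix D assume D: "D \<subseteq> star"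
      have "g (insert v U) (E \<union> D) = of_bool (card (bk (E \<union> D) \<pi> v) < S) *
          (g U E * t ^ card (D \<inter> (\<lambda>w. {v, w}) ` B))"
        using fU insert.hyps(2) same[OF _ D] card_new[OF D]
        by (simp add: g_def power_add)
      \<comment> \<open>The size condition at \<open>v\<close> is given up here; those at the old
        vertices suffice to bound the number of its candidates.\<close>
      also have "\<dots> \<le> 1 * (g U E * t ^ card (D \<inter> (\<lambda>w. {v, w}) ` B))"
        using g0 t by (intro mult_right_mono) auto
      finally show "g (insert v U) (E \<union> D) \<le> g U E * t ^ card (D \<inter> (\<lambda>w. {v, w}) ` B)" by simp
    qed
    also have "\<dots> = g U E * c ^ card B"
    proof -
      have "(\<lambda>w. {v, w}) ` B \<subseteq> star" "finite star" using BU fU by (auto simp: star_def)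
      then have "bern p star (\<lambda>D. t ^ card (D \<inter> (\<lambda>w. {v, w}) ` B)) = c ^ card ((\<lambda>w. {v, w}) ` B)"
        unfolding c_def by (intro bern_power_card)
      then show ?thesis by (simp add: bern_cmult card_image inj_on_star)
    qed
    also have "\<dots> \<le> c ^ S * g U E"
    proof (cases "\<forall>u\<in>U. card (bk E \<pi> u) < S")
      case True
      \<comment> \<open>The strict bound on the back neighbours of \<open>\<pi> v\<close> leaves
        room for \<open>\<pi> v\<close> itself.\<close>
      have "card B \<le> S"
      proof (cases "\<pi> v = v")
        case False
        then have "\<pi> v \<in> U" using insert.hyps by auto
        then have "card (bk E \<pi> (\<pi> v)) < S" using True by blast
        then show ?thesis using False card_insert_le_m1[of S "bk E \<pi> (\<pi> v)" "\<pi> v"]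
          by (simp add: B_def)
      qed (simp add: B_def)
      then have "c ^ card B \<le> c ^ S" using c by (rule power_increasing)
      then show ?thesis using mult_right_mono[OF _ g0] by (subst mult.commute) blast
    next
      case False
      then have "g U E = 0" unfolding g_def of_bool_def if_not_P[OF False] by simp
      then show ?thesis by simp
    qed
    finally show ?thesis .
  qed
  have "bern p (pairs (insert v U)) (g (insert v U)) =
      bern p (pairs U) (\<lambda>E. bern p star (\<lambda>D. g (insert v U) (E \<union> D)))"
    unfolding pairs_insert[OF insert.hyps(2)] star_def
    using fU insert.hyps(2) by (intro bern_Un) (auto simp: pairs_Un_star_disjoint)
  also have "\<dots> \<le> bern p (pairs U) (\<lambda>E. c ^ S * g U E)"
    using p step by (intro bern_mono) auto
  also have "\<dots> = c ^ S * bern p (pairs U) (g U)" by (simp add: bern_cmult)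
  also have "\<dots> \<le> c ^ S * (c ^ S) ^ card U"
    using insert.IH c by (intro mult_left_mono) (auto simp: g_def[abs_def] c_def)
  finally show ?case
    using fU insert.hyps(2) by (simp add: g_def[abs_def] c_def del: sum.insert)
qed

text \<open>Markov's inequality for \<open>t\<close> raised to the total number of back neighbours,
  with a union bound over the parent functions, which gives the factor \<open>n ^ n\<close>. There
  is no union over \<open>F\<close>: passing from \<open>F\<close> to \<open>E\<close> only enlarges
  the back neighbourhoods. Excluding cliques of size \<open>Suc S\<close> keeps these below
  \<open>S\<close>, because a vertex forms a clique with its back neighbours.\<close>

lemma prob_large_chordal_le:
  assumes p: "0 \<le> p" "p \<le> 1" and t: "1 \<le> t"
  shows "bern p (all_pairs n) (\<lambda>E. of_bool ((\<exists>F\<subseteq>E. chordal F \<and> M \<le> card F) \<and>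
      \<not> (\<exists>C\<subseteq>{1..n}. card C = Suc S \<and> clique E C)))
    \<le> real n ^ n * ((1 - p + p * t) ^ S) ^ n / t ^ M"
proof -
  define V where "V = {1..n}"
  \<comment> \<open>Extensional functions are taken so that each parent function on \<open>V\<close>
    is counted once and the family is finite.\<close>
  define Q where "Q = {\<pi> \<in> V \<rightarrow>\<^sub>E V. forest \<pi> V}"
  have fQ: "finite Q" unfolding Q_def V_def by (auto intro!: finite_PiE)
  have cQ: "card Q \<le> n ^ n"
  proof -
    have "card Q \<le> card (V \<rightarrow>\<^sub>E V)" unfolding Q_def V_def by (intro card_mono finite_PiE) auto
    then show ?thesis by (simp add: card_PiE V_def)
  qed
  define g where "g \<pi> E = of_bool (\<forall>v\<in>V. card (bk E \<pi> v) < S) * t ^ (\<Sum>v\<in>V. card (bk E \<pi> v))" for \<pi> E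
  have g0: "0 \<le> g \<pi> E" for \<pi> E using t by (simp add: g_def)
  have main: "of_bool ((\<exists>F\<subseteq>E. chordal F \<and> M \<le> card F) \<and>
      \<not> (\<exists>C\<subseteq>{1..n}. card C = Suc S \<and> clique E C)) \<le> (1 / t ^ M) * (\<Sum>\<pi>\<in>Q. g \<pi> E)"
    (is "of_bool ?P \<le> _") if E: "E \<subseteq> pairs V" for E
  proof (cases ?P)
    case False
    have "0 \<le> (1 / t ^ M) * (\<Sum>\<pi>\<in>Q. g \<pi> E)" using t by (intro mult_nonneg_nonneg sum_nonneg g0) auto
    then show ?thesis unfolding of_bool_def if_not_P[OF False] .
  next
    case True
    then obtain F where F: "F \<subseteq> E" "chordal F" "M \<le> card F" by blast
    have nc: "\<not> clique E C" if "C \<subseteq> V" "card C = Suc S" for C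
      using True that by (auto simp: V_def)
    obtain \<pi>0 where \<pi>0: "forest \<pi>0 V" "card (F \<inter> pairs V) \<le> (\<Sum>v\<in>V. card (bk F \<pi>0 v))"
      using chordal_forest[OF F(2), of V V] F(1) E by (auto simp: V_def)
    define \<pi> where "\<pi> = restrict \<pi>0 V"
    have cl: "\<And>v. v \<in> V \<Longrightarrow> \<pi>0 v \<in> V" using forest_closed[OF \<pi>0(1)] .
    have "forest \<pi> V" using \<pi>0(1) by (rule forest_cong) (simp add: \<pi>_def)
    moreover have "\<pi> \<in> V \<rightarrow>\<^sub>E V" using cl by (auto simp: \<pi>_def)
    ultimately have \<pi>Q: "\<pi> \<in> Q" by (simp add: Q_def)
    have cl': "\<And>v. v \<in> V \<Longrightarrow> \<pi> v \<in> V" using cl by (simp add: \<pi>_def)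
    have "M \<le> (\<Sum>v\<in>V. card (bk F \<pi>0 v))"
      using F(1,3) E \<pi>0(2) by (simp add: inf.absorb1 subset_trans)
    also have "\<dots> \<le> (\<Sum>v\<in>V. card (bk E \<pi> v))"
    proof (rule sum_mono)
      fix v assume v: "v \<in> V"
      have "bk F \<pi>0 v = bk F \<pi> v"
        using cl' v by (intro bk_cong[of V]) (auto simp: \<pi>_def)
      also have "\<dots> \<subseteq> bk E \<pi> v" using F(1) by (rule bk_mono)
      finally show "card (bk F \<pi>0 v) \<le> card (bk E \<pi> v)"
        using finite_subset[OF bk_subset[where U = V and E = E and \<pi> = \<pi>, OF cl' v]]
        by (intro card_mono) (simp_all add: V_def)
    qed
    finally have "t ^ M \<le> t ^ (\<Sum>v\<in>V. card (bk E \<pi> v))"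
      using t by (intro power_increasing)
    moreover have "\<forall>v\<in>V. card (bk E \<pi> v) < S"
      using card_bk_less[OF E cl' _ _ nc] by (auto simp: V_def)
    ultimately have "t ^ M \<le> g \<pi> E" by (simp add: g_def)
    also have "\<dots> \<le> (\<Sum>\<pi>\<in>Q. g \<pi> E)"
      using fQ \<pi>Q g0 by (intro member_le_sum) auto
    finally show ?thesis using True t by (simp add: field_simps)
  qed
  have "bern p (pairs V) (\<lambda>E. of_bool ((\<exists>F\<subseteq>E. chordal F \<and> M \<le> card F) \<and>
      \<not> (\<exists>C\<subseteq>{1..n}. card C = Suc S \<and> clique E C))) \<le> bern p (pairs V) (\<lambda>E. (1 / t ^ M) * (\<Sum>\<pi>\<in>Q. g \<pi> E))"
    using p main by (intro bern_mono)
  also have "\<dots> = (1 / t ^ M) * (\<Sum>\<pi>\<in>Q. bern p (pairs V) (g \<pi>))"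
    by (simp only: bern_cmult bern_sum)
  also have "\<dots> \<le> (1 / t ^ M) * (\<Sum>\<pi>\<in>Q. ((1 - p + p * t) ^ S) ^ n)"
  proof (intro mult_left_mono sum_mono)
    fix \<pi> assume "\<pi> \<in> Q"
    then have "forest \<pi> V" by (simp add: Q_def)
    from forest_moment_le[OF this p t, of S]
    show "bern p (pairs V) (g \<pi>) \<le> ((1 - p + p * t) ^ S) ^ n"
      by (simp add: g_def[abs_def] V_def)
  qed (use t in simp)
  also have "\<dots> \<le> (1 / t ^ M) * (real n ^ n * ((1 - p + p * t) ^ S) ^ n)"
  proof -
    have "0 \<le> ((1 - p + p * t) ^ S) ^ n" using p t by simp
    moreover have "real (card Q) \<le> real n ^ n" using cQ by (metis of_nat_le_iff of_nat_power)
    ultimately show ?thesis using t by (intro mult_left_mono) (auto intro: mult_right_mono)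
  qed
  finally show ?thesis by (simp add: all_pairs_eq V_def)
qed

lemma prob_clique_le:
  assumes p: "0 \<le> p" "p \<le> 1"
  shows "bern p (all_pairs n) (\<lambda>E. of_bool (\<exists>C\<subseteq>{1..n}. card C = s \<and> clique E C))
    \<le> real n ^ s * p ^ (s choose 2)"
proof -
  define \<C> where "\<C> = {C. C \<subseteq> {1..n} \<and> card C = s}"
  have f\<C>: "finite \<C>" by (simp add: \<C>_def)
  have "card \<C> = n choose s" by (simp add: \<C>_def n_subsets)
  also have "\<dots> \<le> n ^ s"
    by (cases "s \<le> n") (simp_all add: binomial_le_pow binomial_eq_0)
  finally have c\<C>: "real (card \<C>) \<le> real n ^ s" by (metis of_nat_le_iff of_nat_power)
  have "bern p (all_pairs n) (\<lambda>E. of_bool (\<exists>C\<subseteq>{1..n}. card C = s \<and> clique E C))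
    \<le> bern p (all_pairs n) (\<lambda>E. \<Sum>C\<in>\<C>. of_bool (pairs C \<subseteq> E))"
  proof (rule bern_mono[OF p])
    fix E assume "E \<subseteq> all_pairs n"
    show "of_bool (\<exists>C\<subseteq>{1..n}. card C = s \<and> clique E C) \<le> (\<Sum>C\<in>\<C>. of_bool (pairs C \<subseteq> E) :: real)"
    proof (cases "\<exists>C\<subseteq>{1..n}. card C = s \<and> clique E C")
      case True
      then obtain C where C: "C \<in> \<C>" "pairs C \<subseteq> E" by (auto simp: \<C>_def clique_iff_pairs)
      then have "(1::real) \<le> of_bool (pairs C \<subseteq> E)" by simp
      also have "\<dots> \<le> (\<Sum>C\<in>\<C>. of_bool (pairs C \<subseteq> E))"
        using f\<C> C by (intro member_le_sum) auto
      finally show ?thesis using True by simp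
    next
      case False
      then show ?thesis unfolding of_bool_def if_not_P[OF False] by (simp add: sum_nonneg)
    qed
  qed
  also have "\<dots> = (\<Sum>C\<in>\<C>. bern p (all_pairs n) (\<lambda>E. of_bool (pairs C \<subseteq> E)))"
    by (rule bern_sum)
  also have "\<dots> = (\<Sum>C\<in>\<C>. p ^ (s choose 2))"
  proof (rule sum.cong[OF refl])
    fix C assume C: "C \<in> \<C>"
    then have "finite C" using finite_subset[of C "{1..n}"] by (simp add: \<C>_def)
    moreover have "card C = s" "pairs C \<subseteq> all_pairs n" using C
      by (auto simp: \<C>_def all_pairs_eq pairs_mono)
    ultimately show "bern p (all_pairs n) (\<lambda>E. of_bool (pairs C \<subseteq> E)) = p ^ (s choose 2)"
      by (simp add: bern_superset card_pairs)
  qed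
  also have "\<dots> \<le> real n ^ s * p ^ (s choose 2)"
    using c\<C> p by (simp add: mult_right_mono)
  finally show ?thesis .
qed


section \<open>The constant \<open>\<gamma>\<close>\<close>

definition bin_KL :: "real \<Rightarrow> real \<Rightarrow> real" where
  "bin_KL x p = x * ln (x / p) + (1 - x) * ln ((1 - x) / (1 - p))"

text \<open>The derivative is the logarithm of the odds ratio of \<open>z\<close> to
  \<open>p\<close>, positive for \<open>z > p\<close>. This is what makes \<gamma> unique.\<close>

lemma bin_KL_strict_mono:
  assumes p: "0 < p" "p < 1" and xy: "p \<le> x" "x < y" "y < 1"
  shows "bin_KL x p < bin_KL y p"
proof (rule DERIV_pos_imp_increasing_open[OF xy(2)])
  fix z assume z: "x < z" "z < y"
  have "DERIV (\<lambda>x. bin_KL x p) z :> ln (z / p) - ln ((1 - z) / (1 - p))"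
  proof -
    have "DERIV (\<lambda>x. bin_KL x p) z :> (1 * ln (z / p) + z * ((1 / p) / (z / p))) +
      ((- 1) * ln ((1 - z) / (1 - p)) + (1 - z) * ((- 1 / (1 - p)) / ((1 - z) / (1 - p))))"
      unfolding bin_KL_def using p xy z by (auto intro!: derivative_eq_intros) (simp add: field_simps)
    moreover have "(1 * ln (z / p) + z * ((1 / p) / (z / p))) +
      ((- 1) * ln ((1 - z) / (1 - p)) + (1 - z) * ((- 1 / (1 - p)) / ((1 - z) / (1 - p)))) =
      ln (z / p) - ln ((1 - z) / (1 - p))" using p xy z by simp
    ultimately show ?thesis by (simp only:)
  qed
  moreover have "(1 - z) / (1 - p) < z / p"
    using p xy z by (simp add: field_simps)
  moreover have "0 < (1 - z) / (1 - p)"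
    using p xy z by simp
  ultimately show "\<exists>d. DERIV (\<lambda>x. bin_KL x p) z :> d \<and> 0 < d"
    by (metis diff_gt_0_iff_gt ln_less_cancel_iff order_less_trans)
next
  show "continuous_on {x..y} (\<lambda>x. bin_KL x p)"
    unfolding bin_KL_def using p xy by (intro continuous_intros) auto
qed

lemma gamma_eq_iff_bin_KL:
  assumes p: "0 < p" "p < 1" and g: "0 < g" "g < 2"
  shows "gamma_eq p g \<longleftrightarrow> bin_KL (g / 2) p = ln (1 / p) / 2"
proof -
  define x where "x = g / 2"
  have x: "0 < x" "x < 1" "g = 2 * x" using g by (auto simp: x_def)
  have "2 / g = 1 / x" "2 / (2 - g) = 1 / (1 - x)" using x by (auto simp: field_simps)
  then show ?thesis
    unfolding gamma_eq_def x_def[symmetric] bin_KL_def using p x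
    by (simp add: ln_div algebra_simps) argo
qed

text \<open>Existence by the intermediate value theorem: at \<open>max (1/2) p\<close> the relative
  entropy is below \<open>ln (1/p) / 2\<close>, and it tends to \<open>ln (1/p)\<close> as its
  argument tends to 1. Monotonicity gives uniqueness, so the description by \<open>THE\<close> is
  justified.\<close>

lemma gamma_properties:
  assumes p: "0 < p" "p < 1"
  shows "1 < gamma p" "2 * p < gamma p" "gamma p < 2" "bin_KL (gamma p / 2) p = ln (1 / p) / 2"
proof -
  define a where "a = max (1 / 2) p"
  have a: "p \<le> a" "1 / 2 \<le> a" "a < 1" using p by (auto simp: a_def)
  have lnp: "ln p < 0" using p by simp
  have low: "bin_KL a p < ln (1 / p) / 2"
  proof (cases "p \<ge> 1 / 2")
    case True
    then show ?thesis using p lnp by (simp add: a_def bin_KL_def max_def ln_div)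
  next
    case False
    \<comment> \<open>At the argument \<open>1/2\<close> the inequality amounts to
      \<open>(1/2)^2 < 1 - p\<close>.\<close>
    have "2 * ln (1 / 2) = ln (1 / 4 :: real)"
      using ln_mult[of "1/2" "1/2::real"] by simp
    also have "\<dots> < ln (1 - p)" using False p by simp
    finally have "2 * ln (1 / 2) < ln (1 - p)" .
    moreover have "bin_KL a p = (1 / 2) * ln ((1 / 2) / p) + (1 / 2) * ln ((1 / 2) / (1 - p))"
      using False by (simp add: a_def bin_KL_def max_def)
    moreover have "ln ((1 / 2) / p) = ln (1 / 2) - ln p" "ln ((1 / 2) / (1 - p)) = ln (1 / 2) - ln (1 - p)"
      "ln (1 / p) = - ln p"
      using p by (simp_all only: ln_div) simp_all
    ultimately show ?thesis by argo
  qed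
  have "((\<lambda>x. bin_KL x p) \<longlongrightarrow> ln (1 / p)) (at_left 1)"
  proof -
    have "((\<lambda>x::real. (1 - x) * ln (1 - x)) \<longlongrightarrow> 0) (at_left 1)" by real_asymp
    then have "((\<lambda>x. x * ln (x / p) + ((1 - x) * ln (1 - x) - (1 - x) * ln (1 - p))) \<longlongrightarrow>
        1 * ln (1 / p) + (0 - (1 - 1) * ln (1 - p))) (at_left 1)"
      using p by (intro tendsto_intros) auto
    moreover have "\<forall>\<^sub>F x in at_left 1. x * ln (x / p) + ((1 - x) * ln (1 - x) - (1 - x) * ln (1 - p)) = bin_KL x p"
      using eventually_at_left_real[of 0 1]
      by (rule eventually_mono) (use p in \<open>auto simp: bin_KL_def ln_div algebra_simps\<close>)
    ultimately show ?thesis using filterlim_cong[OF refl refl] by fastforce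
  qed
  then have "\<forall>\<^sub>F x in at_left 1. ln (1 / p) / 2 < bin_KL x p"
    using lnp p by (intro order_tendstoD) (auto simp: ln_div)
  moreover have "\<forall>\<^sub>F x in at_left 1. x \<in> {a<..<1}" using a by (intro eventually_at_left_real)
  ultimately have "\<forall>\<^sub>F x in at_left 1. ln (1 / p) / 2 < bin_KL x p \<and> x \<in> {a<..<1}"
    by (rule eventually_conj)
  then obtain y where y: "ln (1 / p) / 2 < bin_KL y p" "a < y" "y < 1"
    using eventually_happens[of _ "at_left (1::real)"] by auto
  have "continuous_on {a..y} (\<lambda>x. bin_KL x p)"
    unfolding bin_KL_def using p a y by (intro continuous_intros) auto
  then obtain x where x: "a \<le> x" "x \<le> y" "bin_KL x p = ln (1 / p) / 2"
    using IVT'[of "\<lambda>x. bin_KL x p" a "ln (1 / p) / 2" y] low y by auto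
  then have "a < x" "x < 1" using low y by (cases "a = x"; auto)+
  have eq: "gamma p = 2 * x"
    unfolding gamma_def
  proof (rule the_equality)
    show "max 1 (2 * p) < 2 * x \<and> 2 * x < 2 \<and> gamma_eq p (2 * x)"
      using gamma_eq_iff_bin_KL[OF p, of "2 * x"] x \<open>a < x\<close> \<open>x < 1\<close> a by (auto simp: a_def)
  next
    fix g assume g: "max 1 (2 * p) < g \<and> g < 2 \<and> gamma_eq p g"
    then have "bin_KL (g / 2) p = bin_KL x p"
      using gamma_eq_iff_bin_KL[OF p, of g] x by auto
    moreover have "p \<le> g / 2" "g / 2 < 1" using g by auto
    ultimately show "g = 2 * x"
      using bin_KL_strict_mono[OF p, of "g / 2" x] bin_KL_strict_mono[OF p, of x "g / 2"] \<open>x < 1\<close> \<open>a < x\<close> a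
      by (cases "g / 2" x rule: linorder_cases) auto
  qed
  show "1 < gamma p" "2 * p < gamma p" "gamma p < 2" "bin_KL (gamma p / 2) p = ln (1 / p) / 2"
    using eq x \<open>a < x\<close> \<open>x < 1\<close> a by auto
qed

text \<open>The parameter optimal in the exponential moment bound for the event that a binomial variable
  exceeds the fraction \<open>x\<close> of its range.\<close>
definition tilt :: "real \<Rightarrow> real \<Rightarrow> real" where
  "tilt x p = x * (1 - p) / ((1 - x) * p)"

lemma tilt_gt_1: "0 < p \<Longrightarrow> p < x \<Longrightarrow> x < 1 \<Longrightarrow> 1 < tilt x p"
  by (simp add: tilt_def field_simps)

lemma tilt_mgf: "0 < p \<Longrightarrow> p < x \<Longrightarrow> x < 1 \<Longrightarrow> 1 - p + p * tilt x p = (1 - p) / (1 - x)"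
  by (simp add: tilt_def field_simps)

text \<open>The Legendre form of the relative entropy: the exponent of the moment bound at its
  optimal parameter, where the generating function takes the value
  \<open>(1 - p) / (1 - x)\<close>.\<close>

lemma bin_KL_eq_tilt:
  "0 < p \<Longrightarrow> p < x \<Longrightarrow> x < 1 \<Longrightarrow> bin_KL x p = x * ln (tilt x p) - ln ((1 - p) / (1 - x))"
proof -
  assume *: "0 < p" "p < x" "x < 1"
  then have eq: "ln (tilt x p) = ln x + ln (1 - p) - (ln (1 - x) + ln p)"
    by (simp add: tilt_def ln_div ln_mult)
  show ?thesis unfolding eq using * by (simp add: bin_KL_def ln_div algebra_simps)
qed

section \<open>The upper bound\<close>

lemma upper_tail_le:
  fixes p x L lam :: real and n :: nat
  assumes p: "0 < p" "p < 1" and x: "p < x" "x < 1" "bin_KL x p = ln (1 / p) / 2"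
  defines "L \<equiv> log (1 / p) (real n)" and "lam \<equiv> log (1 / p) (ln (real n))"
  assumes n: "1 \<le> n" and lam: "0 \<le> lam"
    and big: "2 * ln ((1 - p) / (1 - x)) + 1 \<le> 10 * lam * ln (tilt x p)"
  shows "bern p (all_pairs n) (\<lambda>E. of_bool (\<exists>F\<subseteq>E. chordal F \<and> 2 * x * n * L + 10 * real n * lam < card F))
    \<le> exp (- real n) + 1 / n"
proof -
  define b where "b = ln (1 / p)"
  have b: "0 < b" "ln p = - b" using p by (auto simp: b_def ln_div)
  have L: "L * b = ln n" "0 \<le> L"
    using b n p by (auto simp: L_def log_def b_def[symmetric])
  define t where "t = tilt x p"
  define c where "c = (1 - p) / (1 - x)"
  have t: "1 < t" using tilt_gt_1 p x by (simp add: t_def)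
  have c: "1 < c" "1 - p + p * t = c" using p x tilt_mgf by (auto simp: c_def t_def)
  have lc: "0 < ln c" and lt: "0 < ln t" using c t by auto
  have KL: "x * ln t - ln c = b / 2"
    using bin_KL_eq_tilt[OF p(1) x(1,2)] x(3) by (simp add: t_def c_def b_def)
  \<comment> \<open>Chosen just above \<open>2L\<close>: large enough for a first moment bound to
    exclude cliques of size \<open>Suc S\<close>, while costing only a bounded number of trials
    beyond \<open>2L\<close>.\<close>
  define S where "S = Suc (nat \<lceil>2 * L\<rceil>)"
  have S: "2 * L + 1 \<le> S" "S \<le> 2 * L + 2" using L(2) by (auto simp: S_def) linarith+
  define T where "T = 2 * x * n * L + 10 * real n * lam"
  define M where "M = nat \<lceil>T\<rceil>"
  have T0: "0 \<le> T" using L lam p x by (simp add: T_def)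
  have M: "T \<le> M" using T0 by (simp add: M_def)
  let ?big = "\<lambda>E. \<exists>F\<subseteq>E. chordal F \<and> M \<le> card F"
  let ?cl = "\<lambda>E. \<exists>C\<subseteq>{1..n}. card C = Suc S \<and> clique E C"
  have "bern p (all_pairs n) (\<lambda>E. of_bool (\<exists>F\<subseteq>E. chordal F \<and> T < card F))
    \<le> bern p (all_pairs n) (\<lambda>E. of_bool (?big E \<and> \<not> ?cl E) + of_bool (?cl E))"
  proof (rule bern_mono)
    fix E :: "nat set set"
    have imp: "?big E" if "\<exists>F\<subseteq>E. chordal F \<and> T < card F"
    proof -
      obtain F where "F \<subseteq> E" "chordal F" "T < card F" using \<open>\<exists>F\<subseteq>E. _\<close> by blast
      moreover have "M \<le> card F" using \<open>T < card F\<close> T0 unfolding M_def by linarith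
      ultimately show ?thesis by blast
    qed
    have key: "of_bool P \<le> (of_bool (Q \<and> \<not> R) + of_bool R :: real)" if "P \<Longrightarrow> Q" for P Q R
      using that by (cases P; cases Q; cases R) auto
    show "of_bool (\<exists>F\<subseteq>E. chordal F \<and> T < card F) \<le> (of_bool (?big E \<and> \<not> ?cl E) + of_bool (?cl E) :: real)"
      by (rule key) (rule imp)
  qed (use p in auto)
  also have "\<dots> = bern p (all_pairs n) (\<lambda>E. of_bool (?big E \<and> \<not> ?cl E)) + bern p (all_pairs n) (\<lambda>E. of_bool (?cl E))"
    by (rule bern_add)
  also have "bern p (all_pairs n) (\<lambda>E. of_bool (?big E \<and> \<not> ?cl E)) \<le> exp (- real n)"
  proof -
    have "bern p (all_pairs n) (\<lambda>E. of_bool (?big E \<and> \<not> ?cl E)) \<le> real n ^ n * (c ^ S) ^ n / t ^ M"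
      using prob_large_chordal_le[of p t n M S] p t c by simp
    also have "\<dots> = exp (n * ln n + n * (S * ln c) - M * ln t)"
      using n c t by (simp add: exp_add exp_diff exp_of_nat_mult)
    also have "n * ln n + n * (S * ln c) - M * ln t \<le> n * (L * b) + n * ((2 * L + 2) * ln c) - T * ln t"
      using L S M lc lt by (intro diff_mono add_mono mult_left_mono mult_right_mono) auto
    \<comment> \<open>The terms of order \<open>L\<close>, the cost of the union bound and the gain
      from the moment, cancel by the equation for \<open>x\<close>. What remains is
      \<open>2 * ln c\<close>, the price of rounding \<open>S\<close> up, against the error
      term.\<close>
    also have "\<dots> = n * (L * (b - 2 * (x * ln t - ln c)) + 2 * ln c - 10 * lam * ln t)"
      by (simp add: T_def algebra_simps)
    also have "\<dots> = n * (2 * ln c - 10 * lam * ln t)"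
      unfolding KL by simp
    also have "\<dots> \<le> real n * (- 1)"
      using big by (intro mult_left_mono) (auto simp: c_def t_def)
    finally show ?thesis by simp
  qed
  also have "bern p (all_pairs n) (\<lambda>E. of_bool (?cl E)) \<le> 1 / n"
  proof -
    have "bern p (all_pairs n) (\<lambda>E. of_bool (?cl E)) \<le> real n ^ Suc S * p ^ (Suc S choose 2)"
      using prob_clique_le[of p n "Suc S"] p by simp
    also have "\<dots> = exp (Suc S * ln n + (Suc S choose 2) * ln p)"
      using n p by (simp only: exp_add exp_of_nat_mult) simp
    also have "real (Suc S choose 2) = Suc S * (real S / 2)"
    proof -
      have "2 * (Suc S choose 2) = Suc S * S" using choose_two[of "Suc S"] by simp
      then have "2 * real (Suc S choose 2) = Suc S * real S" by (metis of_nat_mult of_nat_numeral)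
      then show ?thesis by simp
    qed
    also have "Suc S * ln n + Suc S * (real S / 2) * ln p = Suc S * (L * b - S * b / 2)"
      by (simp only: L(1)[symmetric] b(2)) (simp add: field_simps)
    \<comment> \<open>Each vertex of the clique contributes at most \<open>- b / 2\<close> because
      \<open>S\<close> is at least \<open>2 * L + 1\<close>; in total this is at most
      \<open>- L * b = - ln n\<close>.\<close>
    also have "\<dots> \<le> Suc S * (- b / 2)"
    proof (intro mult_left_mono)
      have "(2 * L + 1) * b \<le> S * b" using S b by (intro mult_right_mono) auto
      then show "L * b - S * b / 2 \<le> - b / 2" by (simp add: algebra_simps)
    qed simp
    also have "\<dots> \<le> - ln n"
    proof -
      have "2 * L * b \<le> Suc S * b" using S b by (intro mult_right_mono) auto
      then show ?thesis using L by (simp add: algebra_simps)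
    qed
    also have "exp (- ln (real n)) = 1 / n" using n by (simp add: exp_minus divide_inverse)
    finally show ?thesis by simp
  qed
  finally show ?thesis by (simp add: T_def)
qed

lemma upper_tail_tendsto:
  fixes p x :: real
  assumes p: "0 < p" "p < 1" and x: "p < x" "x < 1" "bin_KL x p = ln (1 / p) / 2"
  shows "(\<lambda>n. bern p (all_pairs n) (\<lambda>E. of_bool (\<exists>F\<subseteq>E. chordal F \<and>
    2 * x * n * log (1 / p) (real n) + 10 * real n * log (1 / p) (ln (real n)) < card F))) \<longlonglongrightarrow> 0"
proof (rule tendsto_sandwich[of "\<lambda>_. 0" _ _ "\<lambda>n. exp (- real n) + 1 / n"])
  define b where "b = ln (1 / p)"
  have b: "0 < b" using p by (auto simp: b_def)
  define c where "c = ln ((1 - p) / (1 - x))"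
  define t where "t = ln (tilt x p)"
  have t: "0 < t" using tilt_gt_1[of p x] p x by (simp add: t_def)
  have "\<forall>\<^sub>F n in sequentially. 2 * c + 1 \<le> 10 * (ln (ln (real n)) / b) * t"
    using b t by real_asymp
  moreover have "\<forall>\<^sub>F n in sequentially. 0 \<le> ln (ln (real n)) / b" using b by real_asymp
  ultimately show "\<forall>\<^sub>F n in sequentially. bern p (all_pairs n) (\<lambda>E. of_bool (\<exists>F\<subseteq>E. chordal F \<and>
    2 * x * n * log (1 / p) (real n) + 10 * real n * log (1 / p) (ln (real n)) < card F)) \<le> exp (- real n) + 1 / n"
    using eventually_ge_at_top[of 1]
  proof eventually_elim
    case (elim n)
    then show ?case
      using upper_tail_le[OF p x, where n = n] by (simp add: b_def c_def t_def log_def)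
  qed
  show "(\<lambda>n. exp (- real n) + 1 / n) \<longlonglongrightarrow> 0" by real_asymp
  show "\<forall>\<^sub>F n in sequentially. 0 \<le> bern p (all_pairs n) (\<lambda>E. of_bool (\<exists>F\<subseteq>E. chordal F \<and>
    2 * x * n * log (1 / p) (real n) + 10 * real n * log (1 / p) (ln (real n)) < card F))"
    using p by (intro always_eventually allI bern_nonneg) auto
qed (rule tendsto_const)


section \<open>Disjoint cliques by the second moment method\<close>

text \<open>The ratio of the binomials is a product of \<open>i\<close> factors
  \<open>(k - j) / (m - j)\<close>, each at most \<open>k / m\<close>.\<close>

lemma binomial_diff_le:
  assumes "i \<le> k" "k \<le> m" "0 < m"
  shows "real ((m - i) choose (k - i)) \<le> real (m choose k) * (real k / real m) ^ i"
  using assms(1)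
proof (induction i)
  case 0
  then show ?case by simp
next
  case (Suc i)
  have ik: "i < k" "i < m" using Suc.prems assms by auto
  then have s: "m - i = Suc (m - Suc i)" "k - i = Suc (k - Suc i)" by auto
  have "(k - i) * ((m - i) choose (k - i)) = (m - i) * ((m - Suc i) choose (k - Suc i))"
    unfolding s using Suc_times_binomial_eq[of "m - Suc i" "k - Suc i"] by (simp add: mult.commute)
  then have "real (k - i) * ((m - i) choose (k - i)) = real (m - i) * ((m - Suc i) choose (k - Suc i))"
    by (metis of_nat_mult)
  then have "real ((m - Suc i) choose (k - Suc i)) = real (k - i) / real (m - i) * ((m - i) choose (k - i))"
    using ik by (simp add: field_simps)
  also have "\<dots> \<le> (real k / real m) * (real (m choose k) * (real k / real m) ^ i)"
  proof (rule mult_mono)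
    have "real i * real k \<le> real i * real m" using assms by (intro mult_left_mono) auto
    then show "real (k - i) / real (m - i) \<le> real k / real m"
      using ik assms by (simp add: field_simps of_nat_diff)
  qed (use Suc ik in auto)
  finally show ?case by (simp add: mult_ac)
qed

lemma card_supersets_le:
  assumes "finite V" "I \<subseteq> V"
  shows "card {K. K \<subseteq> V \<and> card K = k \<and> I \<subseteq> K} \<le> (card V - card I) choose (k - card I)"
proof -
  have fI: "finite I" using assms finite_subset by blast
  have "{K. K \<subseteq> V \<and> card K = k \<and> I \<subseteq> K} \<subseteq> (\<union>) I ` {J. J \<subseteq> V - I \<and> card J = k - card I}"
  proof
    fix K assume K: "K \<in> {K. K \<subseteq> V \<and> card K = k \<and> I \<subseteq> K}"
    then have "K = I \<union> (K - I)" "K - I \<subseteq> V - I" "card (K - I) = k - card I"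
      using fI by (auto simp: card_Diff_subset)
    then show "K \<in> (\<union>) I ` {J. J \<subseteq> V - I \<and> card J = k - card I}" by blast
  qed
  then have "card {K. K \<subseteq> V \<and> card K = k \<and> I \<subseteq> K} \<le> card {J. J \<subseteq> V - I \<and> card J = k - card I}"
    using assms by (intro surj_card_le) auto
  also have "\<dots> = (card V - card I) choose (k - card I)"
    using assms fI by (simp add: n_subsets card_Diff_subset)
  finally show ?thesis .
qed

text \<open>A bound for the contribution of the pairs of \<open>k\<close>-cliques sharing
  \<open>i\<close> of \<open>m\<close> vertices, relative to the squared expected number of
  \<open>k\<close>-cliques. The power of \<open>1 / p\<close> accounts for the shared edges, which
  are paid for only once.\<close>

definition overlap_weight :: "real \<Rightarrow> nat \<Rightarrow> nat \<Rightarrow> nat \<Rightarrow> real" where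
  "overlap_weight p m k i = (real (k * k) / real m) ^ i * (1 / p) ^ (i choose 2)"

text \<open>The term of \<open>K \<inter> K'\<close> is dominated by the sum over all nonempty
  subsets of \<open>K\<close> contained in \<open>K'\<close>, which avoids counting exact
  intersections. One factor \<open>k ^ i\<close> bounds the choices of the subset;
  \<open>(k / m) ^ i\<close> bounds the fraction of sets \<open>K'\<close> containing it.\<close>

lemma sum_overlap_le:
  assumes "finite V" "K \<subseteq> V" "card K = k" "1 \<le> k" and p: "0 < p"
  shows "(\<Sum>K'\<in>{K'. K' \<subseteq> V \<and> card K' = k}. real (card (K \<inter> K')) * (1 / p) ^ (card (K \<inter> K') choose 2))
    \<le> real (card V choose k) * (\<Sum>i=1..k. real i * overlap_weight p (card V) k i)"
proof -
  define m where "m = card V"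
  define \<K> where "\<K> = {K'. K' \<subseteq> V \<and> card K' = k}"
  define w where "w i = real i * (1 / p) ^ (i choose 2)" for i
  have w0: "0 \<le> w i" for i using p by (simp add: w_def)
  have fK: "finite K" using assms finite_subset by blast
  have f\<K>: "finite \<K>" using assms by (simp add: \<K>_def)
  have km: "k \<le> m" using assms card_mono by (auto simp: m_def)
  define \<I> where "\<I> = {I. I \<subseteq> K \<and> I \<noteq> {}}"
  have f\<I>: "finite \<I>" using fK by (simp add: \<I>_def)
  have "(\<Sum>K'\<in>\<K>. w (card (K \<inter> K'))) \<le> (\<Sum>K'\<in>\<K>. \<Sum>I\<in>\<I>. of_bool (I \<subseteq> K') * w (card I))"
  proof (rule sum_mono)
    fix K' assume "K' \<in> \<K>"
    show "w (card (K \<inter> K')) \<le> (\<Sum>I\<in>\<I>. of_bool (I \<subseteq> K') * w (card I))"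
    proof (cases "K \<inter> K' = {}")
      case True
      then show ?thesis using w0 by (simp add: w_def[of 0] sum_nonneg)
    next
      case False
      then have "K \<inter> K' \<in> \<I>" by (simp add: \<I>_def)
      then have "of_bool (K \<inter> K' \<subseteq> K') * w (card (K \<inter> K')) \<le> (\<Sum>I\<in>\<I>. of_bool (I \<subseteq> K') * w (card I))"
        using f\<I> w0 by (intro member_le_sum) auto
      then show ?thesis by simp
    qed
  qed
  also have "\<dots> = (\<Sum>I\<in>\<I>. w (card I) * (\<Sum>K'\<in>\<K>. of_bool (I \<subseteq> K')))"
    by (subst sum.swap) (simp add: sum_distrib_left mult.commute)
  also have "\<dots> \<le> (\<Sum>I\<in>\<I>. w (card I) * (real (m choose k) * (real k / real m) ^ card I))"
  proof (intro sum_mono mult_left_mono w0)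
    fix I assume I: "I \<in> \<I>"
    then have IK: "I \<subseteq> K" "card I \<le> k" using card_mono[OF fK] assms by (auto simp: \<I>_def)
    have "(\<Sum>K'\<in>\<K>. of_bool (I \<subseteq> K')) = real (card {K. K \<subseteq> V \<and> card K = k \<and> I \<subseteq> K})"
    proof -
      have "(\<Sum>K'\<in>\<K>. of_bool (I \<subseteq> K')) = (\<Sum>K'\<in>{K. K \<subseteq> V \<and> card K = k \<and> I \<subseteq> K}. 1::real)"
        using f\<K> by (intro sum.mono_neutral_cong_right) (auto simp: \<K>_def)
      then show ?thesis by simp
    qed
    also have "\<dots> \<le> real ((m - card I) choose (k - card I))"
      using card_supersets_le[of V I k] IK assms by (simp add: m_def)
    also have "\<dots> \<le> real (m choose k) * (real k / real m) ^ card I"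
      using IK km assms by (intro binomial_diff_le) auto
    finally show "(\<Sum>K'\<in>\<K>. of_bool (I \<subseteq> K')) \<le> real (m choose k) * (real k / real m) ^ card I" .
  qed
  also have "\<dots> = (\<Sum>i=1..k. \<Sum>I\<in>{I\<in>\<I>. card I = i}. w (card I) * (real (m choose k) * (real k / real m) ^ card I))"
  proof (rule sum.group[symmetric])
    show "card ` \<I> \<subseteq> {1..k}"
      using card_mono[OF fK] assms(3) finite_subset[OF _ fK]
      by (auto simp: \<I>_def Suc_le_eq card_gt_0_iff)
  qed (use f\<I> in auto)
  also have "\<dots> \<le> (\<Sum>i=1..k. real (m choose k) * (real i * overlap_weight p m k i))"
  proof (rule sum_mono)
    fix i assume i: "i \<in> {1..k}"
    have "{I \<in> \<I>. card I = i} = {I. I \<subseteq> K \<and> card I = i}" using i by (auto simp: \<I>_def)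
    then have "card {I \<in> \<I>. card I = i} = k choose i" using fK assms(3) by (simp add: n_subsets)
    also have "\<dots> \<le> k ^ i" using i by (simp add: binomial_le_pow)
    finally have c: "real (card {I \<in> \<I>. card I = i}) \<le> real k ^ i" by (metis of_nat_le_iff of_nat_power)
    have "(\<Sum>I\<in>{I\<in>\<I>. card I = i}. w (card I) * (real (m choose k) * (real k / real m) ^ card I))
      = real (card {I \<in> \<I>. card I = i}) * (w i * (real (m choose k) * (real k / real m) ^ i))"
      by simp
    also have "\<dots> \<le> real k ^ i * (w i * (real (m choose k) * (real k / real m) ^ i))"
      using c w0 by (intro mult_right_mono) auto
    also have "\<dots> = real (m choose k) * (real i * overlap_weight p m k i)"
      by (simp add: w_def overlap_weight_def power_mult_distrib power_divide mult_ac)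
    finally show "(\<Sum>I\<in>{I\<in>\<I>. card I = i}. w (card I) * (real (m choose k) * (real k / real m) ^ card I))
      \<le> real (m choose k) * (real i * overlap_weight p m k i)" .
  qed
  finally show ?thesis by (simp add: w_def \<K>_def m_def sum_distrib_left)
qed

lemma pairs_Int: "pairs K \<inter> pairs K' = pairs (K \<inter> K')"
  by (auto simp: pairs_def doubleton_eq_iff)

lemma bern_two_cliques:
  assumes p: "0 < p" and "finite V" "K \<subseteq> V" "K' \<subseteq> V" "card K = k" "card K' = k"
  shows "bern p (pairs V) (\<lambda>E. of_bool (clique E K) * of_bool (clique E K')) =
    (p ^ (k choose 2))\<^sup>2 * (1 / p) ^ (card (K \<inter> K') choose 2)"
proof -
  have fin: "finite K" "finite K'" using assms finite_subset by blast+
  have "bern p (pairs V) (\<lambda>E. of_bool (clique E K) * of_bool (clique E K')) =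
    bern p (pairs V) (\<lambda>E. of_bool (pairs K \<union> pairs K' \<subseteq> E))"
    by (intro bern_cong) (auto simp: clique_iff_pairs)
  also have "\<dots> = p ^ card (pairs K \<union> pairs K')"
    using assms pairs_mono[of K V] pairs_mono[of K' V] by (intro bern_superset) auto
  also have "card (pairs K) + card (pairs K') = card (pairs K \<union> pairs K') + card (pairs K \<inter> pairs K')"
    using fin by (intro card_Un_Int) auto
  then have "2 * (k choose 2) = card (pairs K \<union> pairs K') + (card (K \<inter> K') choose 2)"
    using fin assms by (simp add: card_pairs pairs_Int)
  then have "(p ^ (k choose 2))\<^sup>2 = p ^ card (pairs K \<union> pairs K') * p ^ (card (K \<inter> K') choose 2)"
    by (metis power_add power_mult mult.commute)
  then have "p ^ card (pairs K \<union> pairs K') = (p ^ (k choose 2))\<^sup>2 * (1 / p) ^ (card (K \<inter> K') choose 2)"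
    using p by (simp add: field_simps)
  finally show ?thesis .
qed

section \<open>From many cliques to disjoint cliques\<close>

text \<open>By averaging, at least half of the sets have total overlap at most
  \<open>2 * Z / X\<close>. In a maximal disjoint family of these, each member meets at most
  \<open>2 * Z / X\<close> sets, yet together the members meet all of that half, so there are at
  least \<open>(X / 2) / (2 * Z / X)\<close> of them.\<close>

lemma disjoint_subfamily:
  fixes \<X> :: "'a set set"
  assumes fin: "finite \<X>" and ne: "\<And>K. K \<in> \<X> \<Longrightarrow> finite K \<and> K \<noteq> {}" and X: "\<X> \<noteq> {}"
  defines "Z \<equiv> \<Sum>K\<in>\<X>. \<Sum>K'\<in>\<X>. real (card (K \<inter> K'))"
  shows "\<exists>\<D>\<subseteq>\<X>. pairwise disjnt \<D> \<and> (real (card \<X>))\<^sup>2 / (4 * Z) \<le> card \<D>"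
proof -
  define X where "X = real (card \<X>)"
  define z where "z K = (\<Sum>K'\<in>\<X>. real (card (K \<inter> K')))" for K
  have Z: "Z = (\<Sum>K\<in>\<X>. z K)" by (simp add: Z_def z_def)
  have z0: "0 \<le> z K" for K by (simp add: z_def sum_nonneg)
  have X0: "0 < X" using fin X by (simp add: X_def card_gt_0_iff)
  have z_pos: "0 < z K" if "K \<in> \<X>" for K
  proof -
    have "real (card (K \<inter> K)) \<le> z K"
      unfolding z_def using fin that by (intro member_le_sum) auto
    moreover have "0 < card K" using ne[OF that] by (simp add: card_gt_0_iff)
    ultimately show ?thesis by simp
  qed
  have Z0: "0 < Z" unfolding Z using fin X z_pos by (intro sum_pos) auto
  define low where "low = {K \<in> \<X>. z K \<le> 2 * Z / X}"
  have "X / 2 \<le> card low"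
  proof -
    have "real (card (\<X> - low)) * (2 * Z / X) = (\<Sum>K\<in>\<X> - low. 2 * Z / X)" by simp
    also have "\<dots> \<le> (\<Sum>K\<in>\<X> - low. z K)"
      by (rule sum_mono) (auto simp: low_def)
    also have "\<dots> \<le> Z" unfolding Z using fin z0 by (intro sum_mono2) auto
    finally have "real (card (\<X> - low)) * 2 * Z \<le> X * Z" using X0 by (simp add: field_simps)
    then have "real (card (\<X> - low)) * 2 \<le> X" using Z0 by simp
    moreover have "card (\<X> - low) = card \<X> - card low" "card low \<le> card \<X>"
      using fin by (auto simp: low_def intro: card_Diff_subset card_mono)
    ultimately show ?thesis by (simp add: X_def of_nat_diff)
  qed
  define ok where "ok \<D> \<longleftrightarrow> \<D> \<subseteq> low \<and> pairwise disjnt \<D>" for \<D>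
  have "ok {}" by (simp add: ok_def)
  moreover have "\<forall>\<D>. ok \<D> \<longrightarrow> card \<D> < Suc (card \<X>)"
    using fin by (auto simp: ok_def low_def less_Suc_eq_le intro!: card_mono)
  ultimately obtain \<D> where \<D>: "ok \<D>" and max: "\<And>\<D>'. ok \<D>' \<Longrightarrow> card \<D>' \<le> card \<D>"
    using ex_has_greatest_nat[of ok "{}" card "Suc (card \<X>)"] by metis
  have \<D>low: "\<D> \<subseteq> low" "\<D> \<subseteq> \<X>" "pairwise disjnt \<D>" using \<D> by (auto simp: ok_def low_def)
  have f\<D>: "finite \<D>" using \<D>low fin finite_subset by blast
  have meet: "\<exists>D\<in>\<D>. D \<inter> K \<noteq> {}" if K: "K \<in> low" for K
  proof (rule ccontr)
    assume no: "\<not> (\<exists>D\<in>\<D>. D \<inter> K \<noteq> {})"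
    have "K \<noteq> {}" using K ne by (auto simp: low_def)
    then have "K \<notin> \<D>" using no by blast
    moreover have "ok (insert K \<D>)"
      using \<D>low K no by (auto simp: ok_def pairwise_insert disjnt_def)
    ultimately show False using max[of "insert K \<D>"] f\<D> by simp
  qed
  have "real (card low) \<le> real (card (\<Union>D\<in>\<D>. {K \<in> \<X>. D \<inter> K \<noteq> {}}))"
    using meet f\<D> fin by (intro of_nat_mono card_mono) (auto simp: low_def)
  also have "\<dots> \<le> (\<Sum>D\<in>\<D>. real (card {K \<in> \<X>. D \<inter> K \<noteq> {}}))"
    using of_nat_mono[OF card_UN_le[OF f\<D>], where 'a = real] by (simp only: of_nat_sum)
  also have "\<dots> \<le> (\<Sum>D\<in>\<D>. 2 * Z / X)"
  proof (rule sum_mono)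
    fix D assume D: "D \<in> \<D>"
    have "real (card {K \<in> \<X>. D \<inter> K \<noteq> {}}) = (\<Sum>K\<in>{K \<in> \<X>. D \<inter> K \<noteq> {}}. 1)" by simp
    also have "\<dots> \<le> (\<Sum>K\<in>{K \<in> \<X>. D \<inter> K \<noteq> {}}. real (card (D \<inter> K)))"
    proof (rule sum_mono)
      fix K assume "K \<in> {K \<in> \<X>. D \<inter> K \<noteq> {}}"
      then have "0 < card (D \<inter> K)" using ne[of D] D \<D>low by (auto simp: card_gt_0_iff)
      then show "1 \<le> real (card (D \<inter> K))" by simp
    qed
    also have "\<dots> \<le> z D" unfolding z_def using fin by (intro sum_mono2) auto
    also have "\<dots> \<le> 2 * Z / X" using D \<D>low by (auto simp: low_def)
    finally show "real (card {K \<in> \<X>. D \<inter> K \<noteq> {}}) \<le> 2 * Z / X" .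
  qed
  finally have "X / 2 \<le> card \<D> * (2 * Z / X)" using \<open>X / 2 \<le> card low\<close> by simp
  then have "X\<^sup>2 / (4 * Z) \<le> card \<D>" using X0 Z0 by (simp add: field_simps power2_eq_square)
  then show ?thesis using \<D>low by (auto simp: X_def)
qed

text \<open>Chebyshev keeps the number \<open>X\<close> of \<open>k\<close>-cliques above half its
  mean, and Markov keeps their total overlap \<open>Z\<close> below \<omega> times the bound on its
  mean. Outside these two exceptional events a disjoint subfamily of the claimed size
  exists.\<close>

lemma prob_no_clique_packing_le:
  assumes p: "0 < p" "p \<le> 1" and "finite V" "card V = m" and k: "1 \<le> k" "k \<le> m" and \<omega>: "0 < \<omega>"
    and small: "\<And>i. 2 \<le> i \<Longrightarrow> i \<le> k \<Longrightarrow> overlap_weight p m k i \<le> 1 / m"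
  shows "bern p (pairs V) (\<lambda>E. of_bool (\<not> (\<exists>\<D>. pairwise disjnt \<D> \<and> finite \<D> \<and>
      (\<forall>K\<in>\<D>. K \<subseteq> V \<and> card K = k \<and> clique E K) \<and> real m / (32 * \<omega> * (real k)\<^sup>2) \<le> card \<D>)))
    \<le> 8 * (real k)\<^sup>2 / m + 1 / \<omega>"
proof -
  define \<K> where "\<K> = {K. K \<subseteq> V \<and> card K = k}"
  have f\<K>: "finite \<K>" using assms by (simp add: \<K>_def)
  have c\<K>: "card \<K> = m choose k" using assms by (simp add: \<K>_def n_subsets)
  define q where "q = p ^ (k choose 2)"
  have q: "0 < q" using p by (simp add: q_def)
  define \<mu> where "\<mu> = real (m choose k) * q"
  have \<mu>: "0 < \<mu>" using k q by (simp add: \<mu>_def)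
  define X where "X E = (\<Sum>K\<in>\<K>. of_bool (clique E K) :: real)" for E
  define Z where "Z E = (\<Sum>K\<in>\<K>. \<Sum>K'\<in>\<K>. of_bool (clique E K) * of_bool (clique E K') * real (card (K \<inter> K')))" for E
  have sub: "K \<subseteq> V" "card K = k" "finite K" if "K \<in> \<K>" for K
    using that assms finite_subset by (auto simp: \<K>_def)
  have EX: "bern p (pairs V) X = \<mu>"
  proof -
    have "bern p (pairs V) X = (\<Sum>K\<in>\<K>. bern p (pairs V) (\<lambda>E. of_bool (pairs K \<subseteq> E)))"
      unfolding X_def[abs_def] by (simp add: bern_sum clique_iff_pairs)
    also have "\<dots> = (\<Sum>K\<in>\<K>. q)"
      using sub assms by (intro sum.cong refl) (simp add: bern_superset pairs_mono card_pairs q_def)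
    finally show ?thesis by (simp add: c\<K> \<mu>_def)
  qed
  have pair: "bern p (pairs V) (\<lambda>E. of_bool (clique E K) * of_bool (clique E K')) =
    q\<^sup>2 * (1 / p) ^ (card (K \<inter> K') choose 2)" if "K \<in> \<K>" "K' \<in> \<K>" for K K'
    unfolding q_def using that sub assms by (intro bern_two_cliques) auto
  have EZ: "bern p (pairs V) Z = (\<Sum>K\<in>\<K>. \<Sum>K'\<in>\<K>. q\<^sup>2 * (real (card (K \<inter> K')) * (1 / p) ^ (card (K \<inter> K') choose 2)))"
  proof -
    have "bern p (pairs V) Z = (\<Sum>K\<in>\<K>. \<Sum>K'\<in>\<K>.
        bern p (pairs V) (\<lambda>E. of_bool (clique E K) * of_bool (clique E K')) * real (card (K \<inter> K')))"
      unfolding Z_def[abs_def] bern_sum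
      by (intro sum.cong refl) (simp only: mult.commute[of _ "real _"] bern_cmult)
    then show ?thesis using pair by (simp add: mult_ac)
  qed
  have EZ_le: "bern p (pairs V) Z \<le> \<mu>\<^sup>2 * (2 * (real k)\<^sup>2 / m)"
  proof -
    have m0: "0 < m" using k by simp
    \<comment> \<open>The term \<open>i = 1\<close> is \<open>k^2 / m\<close>, since a single common
      vertex means no common edge; each further term is at most \<open>k / m\<close>.\<close>
    have "(\<Sum>i=1..k. real i * overlap_weight p m k i) \<le> real k * (2 * real k / m)"
    proof -
      have "(\<Sum>i=1..k. real i * overlap_weight p m k i) =
          overlap_weight p m k 1 + (\<Sum>i=2..k. real i * overlap_weight p m k i)"
        using k(1) by (simp add: sum.atLeast_Suc_atMost numeral_2_eq_2)
      also have "(\<Sum>i=2..k. real i * overlap_weight p m k i) \<le> (\<Sum>i=2..k. real k * (1 / m))"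
        using small p by (intro sum_mono mult_mono) (auto simp: overlap_weight_def)
      also have "\<dots> \<le> real k * (real k * (1 / m))"
        using k by (simp add: divide_right_mono of_nat_diff)
      finally show ?thesis by (simp add: overlap_weight_def field_simps binomial_eq_0)
    qed
    then have "real (m choose k) * (\<Sum>i=1..k. real i * overlap_weight p m k i) \<le> real (m choose k) * (2 * (real k)\<^sup>2 / m)"
      by (intro mult_left_mono) (auto simp: power2_eq_square mult_ac)
    then have "(\<Sum>K'\<in>\<K>. real (card (K \<inter> K')) * (1 / p) ^ (card (K \<inter> K') choose 2)) \<le> real (m choose k) * (2 * (real k)\<^sup>2 / m)"
      if "K \<in> \<K>" for K
      using sum_overlap_le[of V K k p] that sub[OF that] assms unfolding \<K>_def by simp
    then have "bern p (pairs V) Z \<le> (\<Sum>K\<in>\<K>. q\<^sup>2 * (real (m choose k) * (2 * (real k)\<^sup>2 / m)))"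
      unfolding EZ by (intro sum_mono) (simp only: sum_distrib_left[symmetric], intro mult_left_mono, auto)
    then show ?thesis by (simp add: c\<K> \<mu>_def power2_eq_square mult_ac)
  qed
  \<comment> \<open>The overlap sum also controls the variance: pairs of sets without a common
    vertex contribute at most \<open>\<mu>^2\<close> in total, and every other pair is counted in
    \<open>Z\<close> with weight at least 1.\<close>
  have EX2: "bern p (pairs V) (\<lambda>E. (X E)\<^sup>2) \<le> \<mu>\<^sup>2 + bern p (pairs V) Z"
  proof -
    have "bern p (pairs V) (\<lambda>E. (X E)\<^sup>2) = (\<Sum>K\<in>\<K>. \<Sum>K'\<in>\<K>.
        bern p (pairs V) (\<lambda>E. of_bool (clique E K) * of_bool (clique E K')))"
      unfolding X_def power2_eq_square sum_product by (simp only: bern_sum)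
    also have "\<dots> = (\<Sum>K\<in>\<K>. \<Sum>K'\<in>\<K>. q\<^sup>2 * (1 / p) ^ (card (K \<inter> K') choose 2))"
      using pair by simp
    also have "\<dots> \<le> (\<Sum>K\<in>\<K>. \<Sum>K'\<in>\<K>. q\<^sup>2 + q\<^sup>2 * (real (card (K \<inter> K')) * (1 / p) ^ (card (K \<inter> K') choose 2)))"
    proof (intro sum_mono)
      fix K K'
      let ?i = "card (K \<inter> K')"
      have "(1 / p) ^ (?i choose 2) \<le> 1 + real ?i * (1 / p) ^ (?i choose 2)"
      proof (cases "?i = 0")
        case True
        then show ?thesis by (simp add: numeral_2_eq_2)
      next
        case False
        then have "1 * (1 / p) ^ (?i choose 2) \<le> real ?i * (1 / p) ^ (?i choose 2)"
          using p by (intro mult_right_mono) auto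
        then show ?thesis by simp
      qed
      then have "q\<^sup>2 * (1 / p) ^ (?i choose 2) \<le> q\<^sup>2 * (1 + real ?i * (1 / p) ^ (?i choose 2))"
        by (intro mult_left_mono) auto
      then show "q\<^sup>2 * (1 / p) ^ (?i choose 2) \<le> q\<^sup>2 + q\<^sup>2 * (real ?i * (1 / p) ^ (?i choose 2))"
        by (simp add: distrib_left)
    qed
    also have "\<dots> = \<mu>\<^sup>2 + bern p (pairs V) Z"
      unfolding EZ by (simp add: sum.distrib c\<K> \<mu>_def power2_eq_square mult_ac)
    finally show ?thesis .
  qed
  have var: "bern p (pairs V) (\<lambda>E. (X E - \<mu>)\<^sup>2) \<le> \<mu>\<^sup>2 * (2 * (real k)\<^sup>2 / m)"
  proof -
    have "bern p (pairs V) (\<lambda>E. (X E - \<mu>)\<^sup>2) = bern p (pairs V) (\<lambda>E. (X E)\<^sup>2 + (\<mu>\<^sup>2 - (2 * \<mu>) * X E))"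
      by (intro bern_cong) (simp add: power2_eq_square algebra_simps)
    also have "\<dots> = bern p (pairs V) (\<lambda>E. (X E)\<^sup>2) + (\<mu>\<^sup>2 - 2 * \<mu> * \<mu>)"
      using EX assms(3) by (simp only: bern_add bern_diff bern_cmult bern_const finite_pairs)
    also have "\<dots> \<le> bern p (pairs V) Z" using EX2 by (simp add: power2_eq_square)
    finally show ?thesis using EZ_le by simp
  qed
  let ?packing = "\<lambda>E. \<exists>\<D>. pairwise disjnt \<D> \<and> finite \<D> \<and>
      (\<forall>K\<in>\<D>. K \<subseteq> V \<and> card K = k \<and> clique E K) \<and> real m / (32 * \<omega> * (real k)\<^sup>2) \<le> card \<D>"
  let ?A = "\<lambda>E. \<mu>\<^sup>2 / 4 \<le> (X E - \<mu>)\<^sup>2" and ?B = "\<lambda>E. \<omega> * (\<mu>\<^sup>2 * (2 * (real k)\<^sup>2 / m)) \<le> Z E"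
  have packing: "?packing E" if nA: "\<not> ?A E" and nB: "\<not> ?B E" for E
  proof -
    have "\<mu> / 2 < X E"
    proof (rule ccontr)
      assume "\<not> \<mu> / 2 < X E"
      then have "\<mu> / 2 \<le> \<mu> - X E" by simp
      then have "(\<mu> / 2)\<^sup>2 \<le> (\<mu> - X E)\<^sup>2" using \<mu> by (intro power_mono) auto
      then show False using nA by (simp add: power2_commute power_divide)
    qed
    define \<X> where "\<X> = {K \<in> \<K>. clique E K}"
    have f\<X>: "finite \<X>" using f\<K> by (simp add: \<X>_def)
    have X: "X E = card \<X>"
      unfolding X_def \<X>_def using f\<K> by (simp add: of_bool_def sum.If_cases Int_def)
    have "\<X> \<noteq> {}" using X \<open>\<mu> / 2 < X E\<close> \<mu> by auto
    have Z: "Z E = (\<Sum>K\<in>\<X>. \<Sum>K'\<in>\<X>. real (card (K \<inter> K')))"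
    proof -
      have restr: "(\<Sum>K\<in>\<K>. of_bool (clique E K) * g K) = (\<Sum>K\<in>\<X>. g K :: real)" for g
        unfolding \<X>_def by (rule sum.mono_neutral_cong_right) (use f\<K> in auto)
      have "Z E = (\<Sum>K\<in>\<K>. of_bool (clique E K) * (\<Sum>K'\<in>\<K>. of_bool (clique E K') * real (card (K \<inter> K'))))"
        by (simp only: Z_def sum_distrib_left mult.assoc)
      then show ?thesis by (simp only: restr)
    qed
    have ne: "finite K \<and> K \<noteq> {}" if "K \<in> \<X>" for K
      using sub[of K] that k by (auto simp: \<X>_def)
    obtain \<D> where \<D>: "\<D> \<subseteq> \<X>" "pairwise disjnt \<D>" "(real (card \<X>))\<^sup>2 / (4 * Z E) \<le> card \<D>"
      using disjoint_subfamily[OF f\<X> ne \<open>\<X> \<noteq> {}\<close>] Z by auto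
    have Z0: "0 < Z E"
    proof -
      obtain K where K: "K \<in> \<X>" using \<open>\<X> \<noteq> {}\<close> by blast
      have "0 < card (K \<inter> K)" using ne[OF K] by (simp add: card_gt_0_iff)
      then have "0 < (\<Sum>K'\<in>\<X>. real (card (K \<inter> K')))"
        using f\<X> K by (intro sum_pos2[of _ K]) auto
      then show ?thesis unfolding Z by (rule sum_pos2[OF f\<X> K]) (simp add: sum_nonneg)
    qed
    have k0: "0 < real k" and m0: "0 < real m" using k by auto
    \<comment> \<open>The 32 is the product of 4 from halving the mean, 4 from the disjoint
      subfamily and 2 from the bound on the mean of \<open>Z\<close>.\<close>
    have "real m / (32 * \<omega> * (real k)\<^sup>2) = (\<mu> / 2)\<^sup>2 / (4 * (\<omega> * (\<mu>\<^sup>2 * (2 * (real k)\<^sup>2 / m))))"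
      using k0 m0 \<mu> \<omega> by (simp add: field_simps power2_eq_square)
    also have "\<dots> \<le> (X E)\<^sup>2 / (4 * Z E)"
      using \<open>\<mu> / 2 < X E\<close> nB \<mu> Z0 by (intro frac_le power_mono) auto
    also have "\<dots> \<le> card \<D>" using \<D> X by simp
    finally have "real m / (32 * \<omega> * (real k)\<^sup>2) \<le> card \<D>" .
    moreover have "finite \<D>" using \<D> f\<X> finite_subset by blast
    ultimately show ?thesis using \<D> sub by (intro exI[of _ \<D>]) (auto simp: \<X>_def)
  qed
  have "bern p (pairs V) (\<lambda>E. of_bool (\<not> ?packing E)) \<le> bern p (pairs V) (\<lambda>E. of_bool (?A E) + of_bool (?B E))"
  proof (rule bern_mono)
    fix E
    have key: "of_bool (\<not> P) \<le> (of_bool A + of_bool B :: real)" if "\<not> A \<Longrightarrow> \<not> B \<Longrightarrow> P" for P A B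
      using that by (cases P; cases A; cases B) auto
    show "of_bool (\<not> ?packing E) \<le> (of_bool (?A E) + of_bool (?B E) :: real)"
      by (rule key) (rule packing)
  qed (use p in auto)
  also have "\<dots> = bern p (pairs V) (\<lambda>E. of_bool (?A E)) + bern p (pairs V) (\<lambda>E. of_bool (?B E))"
    by (rule bern_add)
  also have "bern p (pairs V) (\<lambda>E. of_bool (?A E)) \<le> bern p (pairs V) (\<lambda>E. (X E - \<mu>)\<^sup>2) / (\<mu>\<^sup>2 / 4)"
    using p \<mu> by (intro bern_markov) auto
  also have "\<dots> \<le> \<mu>\<^sup>2 * (2 * (real k)\<^sup>2 / m) / (\<mu>\<^sup>2 / 4)"
    using var by (intro divide_right_mono) auto
  also have "\<dots> = 8 * (real k)\<^sup>2 / m" using \<mu> by simp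
  also have "bern p (pairs V) (\<lambda>E. of_bool (?B E)) \<le> bern p (pairs V) Z / (\<omega> * (\<mu>\<^sup>2 * (2 * (real k)\<^sup>2 / m)))"
  proof (rule bern_markov)
    show "0 < \<omega> * (\<mu>\<^sup>2 * (2 * (real k)\<^sup>2 / m))" using \<omega> \<mu> k by simp
    show "0 \<le> Z E" for E by (simp add: Z_def sum_nonneg)
  qed (use p in auto)
  also have "\<dots> \<le> \<mu>\<^sup>2 * (2 * (real k)\<^sup>2 / m) / (\<omega> * (\<mu>\<^sup>2 * (2 * (real k)\<^sup>2 / m)))"
    using EZ_le \<omega> by (intro divide_right_mono) auto
  also have "\<dots> = 1 / \<omega>" using \<mu> k \<omega> by simp
  finally show ?thesis by simp
qed


section \<open>Attaching the remaining vertices to the cliques\<close>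

lemma bern_card_eq:
  assumes "finite A"
  shows "bern p A (\<lambda>E. of_bool (card E = d)) = real (card A choose d) * p ^ d * (1 - p) ^ (card A - d)"
proof -
  have "bern p A (\<lambda>E. of_bool (card E = d)) = (\<Sum>E\<in>{E. E \<subseteq> A \<and> card E = d}. p ^ d * (1 - p) ^ (card A - d))"
    unfolding bern_def using assms by (intro sum.mono_neutral_cong_right) auto
  then show ?thesis using assms by (simp add: n_subsets)
qed

text \<open>The number \<open>d\<close> is the mode of the binomial distribution with parameters
  \<open>k\<close> and \<open>x\<close>. As its \<open>k + 1\<close> probabilities sum to 1, the
  largest is at least \<open>1 / (k + 1)\<close>.\<close>

lemma binomial_mode_ge:
  assumes x: "0 < x" "x < 1" and d: "d = nat \<lfloor>(real k + 1) * x\<rfloor>"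
  shows "d \<le> k" "1 / (real k + 1) \<le> real (k choose d) * x ^ d * (1 - x) ^ (k - d)"
proof -
  define f where "f j = real (k choose j) * x ^ j * (1 - x) ^ (k - j)" for j
  have f0: "0 \<le> f j" for j using x by (simp add: f_def)
  have d1: "real d \<le> (real k + 1) * x" and d2: "(real k + 1) * x < real d + 1"
    unfolding d using x by (auto intro: mult_nonneg_nonneg)
  have "(real k + 1) * x < real k + 1" using x by simp
  then show dk: "d \<le> k" using d1 by linarith
  have ratio: "f (Suc j) * (real (Suc j) * (1 - x)) = f j * ((real k - real j) * x)" if j: "j < k" for j
  proof -
    have e: "k - j = Suc (k - Suc j)" using j by simp
    have "Suc j * (k choose Suc j) = (k choose j) * (k - j)"
      using binomial_absorb_comp[of k j] binomial_absorption[of j k] by (simp add: mult.commute)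
    then have "real (Suc j) * (k choose Suc j) = (k choose j) * (real k - real j)"
      using j by (metis of_nat_diff of_nat_mult less_imp_le)
    then have "(real (Suc j) * (k choose Suc j)) * (x ^ Suc j * (1 - x) ^ (k - j))
       = ((k choose j) * (real k - real j)) * (x ^ Suc j * (1 - x) ^ (k - j))"
      by (rule arg_cong)
    then show ?thesis unfolding f_def by (simp add: e mult_ac)
  qed
  have up: "f j \<le> f (Suc j)" if j: "j < d" for j
  proof -
    have jk: "j < k" using j dk by simp
    have "real (Suc j) \<le> (real k + 1) * x" using j d1 by linarith
    then have "real (Suc j) * (1 - x) \<le> (real k - real j) * x" by (simp add: algebra_simps)
    then have "f j * (real (Suc j) * (1 - x)) \<le> f (Suc j) * (real (Suc j) * (1 - x))"
      unfolding ratio[OF jk] using f0 by (rule mult_left_mono)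
    then show ?thesis using x by (simp add: mult_le_cancel_right)
  qed
  have down: "f (Suc j) \<le> f j" if j: "d \<le> j" "j < k" for j
  proof -
    have "(real k + 1) * x \<le> real (Suc j)" using j d2 by linarith
    then have le: "(real k - real j) * x \<le> real (Suc j) * (1 - x)" by (simp add: algebra_simps)
    have "f (Suc j) * (real (Suc j) * (1 - x)) \<le> f j * (real (Suc j) * (1 - x))"
      unfolding ratio[OF j(2)] using f0 le by (intro mult_left_mono)
    then show ?thesis using x by (simp add: mult_le_cancel_right)
  qed
  have mode: "f j \<le> f d" if j: "j \<le> k" for j
  proof (cases "j \<le> d")
    case True
    then show ?thesis
      by (induction rule: inc_induct) (use up in \<open>auto intro: order_trans\<close>)
  next
    case False
    then have "d \<le> j" by simp
    then show ?thesis using j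
    proof (induction rule: dec_induct)
      case (step i)
      then show ?case using down[of i] by simp
    qed simp
  qed
  have "1 = (\<Sum>j\<le>k. f j)"
    using binomial_ring[of x "1 - x" k] by (simp add: f_def)
  also have "\<dots> \<le> (\<Sum>j\<le>k. f d)" using mode by (intro sum_mono) auto
  also have "\<dots> = (real k + 1) * f d" by simp
  finally show "1 / (real k + 1) \<le> real (k choose d) * x ^ d * (1 - x) ^ (k - d)"
    by (simp add: f_def field_simps)
qed

text \<open>A change of measure: by \<open>p = r * x / t\<close> and
  \<open>1 - p = r * (1 - x)\<close>, the probability of \<open>d\<close> under \<open>p\<close> is
  \<open>r ^ k / t ^ d\<close> times that under \<open>x\<close>, for which \<open>d\<close> is the
  mode. Since \<open>d\<close> can reach \<open>(k + 1) * x\<close> instead of \<open>k * x\<close>,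
  a factor \<open>t powr x\<close> is lost.\<close>

lemma binomial_tail_ge:
  assumes p: "0 < p" and x: "p < x" "x < 1" and A: "finite A" "card A = k"
    and d: "d = nat \<lfloor>(real k + 1) * x\<rfloor>"
  shows "exp (- (k * bin_KL x p)) / ((real k + 1) * tilt x p powr x) \<le> bern p A (\<lambda>E. of_bool (d \<le> card E))"
proof -
  define t where "t = tilt x p"
  have t: "1 < t" using tilt_gt_1 p x by (simp add: t_def)
  define r where "r = (1 - p) / (1 - x)"
  have r: "0 < r" using p x by (simp add: r_def)
  have pr: "1 - p = r * (1 - x)" "p = r * x / t"
  proof -
    show "1 - p = r * (1 - x)" using x by (simp add: r_def)
    have "p * t = r * x" using p x by (simp add: r_def t_def tilt_def)
    then show "p = r * x / t" using t by (simp add: field_simps)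
  qed
  note mode = binomial_mode_ge[OF _ x(2) d]
  have x0: "0 < x" using p x by simp
  have dk: "d \<le> k" using mode(1) x0 .
  have d1: "real d \<le> (real k + 1) * x" unfolding d using x0 by simp
  have "exp (- (k * bin_KL x p)) = r ^ k / t powr (k * x)"
  proof -
    have "- (k * bin_KL x p) = k * ln r - k * x * ln t"
      unfolding bin_KL_eq_tilt[OF p x] r_def t_def by (simp add: algebra_simps)
    then show ?thesis using r t by (simp add: exp_diff exp_of_nat_mult powr_def)
  qed
  then have "exp (- (k * bin_KL x p)) / ((real k + 1) * t powr x) = r ^ k / t powr ((real k + 1) * x) * (1 / (real k + 1))"
    by (simp add: powr_add[symmetric] algebra_simps)
  also have "\<dots> \<le> r ^ k / t ^ d * (real (k choose d) * x ^ d * (1 - x) ^ (k - d))"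
  proof (intro mult_mono mode(2) x0 divide_left_mono)
    show "t ^ d \<le> t powr ((real k + 1) * x)"
      using d1 t by (subst powr_realpow[symmetric]) (auto intro: powr_mono)
  qed (use r t in auto)
  also have "\<dots> = real (k choose d) * p ^ d * (1 - p) ^ (k - d)"
  proof -
    have "r ^ k = r ^ d * r ^ (k - d)" using dk by (simp add: power_add[symmetric])
    moreover have "p ^ d = r ^ d * x ^ d / t ^ d"
      by (simp only: pr(2) power_mult_distrib power_divide)
    moreover have "(1 - p) ^ (k - d) = r ^ (k - d) * (1 - x) ^ (k - d)"
      by (simp only: pr(1) power_mult_distrib)
    ultimately show ?thesis by simp
  qed
  also have "\<dots> = bern p A (\<lambda>E. of_bool (card E = d))"
    using A by (simp add: bern_card_eq)
  also have "\<dots> \<le> bern p A (\<lambda>E. of_bool (d \<le> card E))"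
  proof (rule bern_mono)
    show "p \<le> 1" using x by simp
  qed (use p in auto)
  finally show ?thesis by (simp add: t_def)
qed

lemma bern_all_small_le:
  assumes "finite \<D>" "pairwise disjnt \<D>" "\<And>K. K \<in> \<D> \<Longrightarrow> finite K"
    and q: "\<And>K. K \<in> \<D> \<Longrightarrow> q \<le> bern p K (\<lambda>E. of_bool (d \<le> card E))"
    and p: "0 \<le> p" "p \<le> 1" and q1: "q \<le> 1"
  shows "bern p (\<Union>\<D>) (\<lambda>E. of_bool (\<forall>K\<in>\<D>. card (E \<inter> K) < d)) \<le> (1 - q) ^ card \<D>"
  using assms(1-4)
proof (induction \<D> rule: finite_induct)
  case empty
  then show ?case by simp
next
  case (insert K \<D>)
  have disj: "K \<inter> \<Union>\<D> = {}"
    using insert.prems(1) insert.hyps(2) by (auto simp: pairwise_insert disjnt_def)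
  have fK: "finite K" and fD: "finite (\<Union>\<D>)" using insert by auto
  have "bern p (\<Union>(insert K \<D>)) (\<lambda>E. of_bool (\<forall>K\<in>insert K \<D>. card (E \<inter> K) < d)) =
    bern p K (\<lambda>E. bern p (\<Union>\<D>) (\<lambda>D. of_bool (\<forall>K\<in>insert K \<D>. card ((E \<union> D) \<inter> K) < d)))"
    using bern_Un[OF fK fD disj] by simp
  also have "\<dots> = bern p K (\<lambda>E. bern p (\<Union>\<D>) (\<lambda>D. of_bool (\<forall>K\<in>\<D>. card (D \<inter> K) < d) * of_bool (card E < d)))"
  proof (intro bern_cong)
    fix E D assume E: "E \<subseteq> K" and D: "D \<subseteq> \<Union>\<D>"
    have "(E \<union> D) \<inter> K = E" using E D disj by blast
    moreover have "(E \<union> D) \<inter> K' = D \<inter> K'" if "K' \<in> \<D>" for K' using E that disj by blast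
    ultimately have "(\<forall>K\<in>insert K \<D>. card ((E \<union> D) \<inter> K) < d) \<longleftrightarrow> (\<forall>K\<in>\<D>. card (D \<inter> K) < d) \<and> card E < d"
      by auto
    then show "of_bool (\<forall>K\<in>insert K \<D>. card ((E \<union> D) \<inter> K) < d) =
      (of_bool (\<forall>K\<in>\<D>. card (D \<inter> K) < d) * of_bool (card E < d) :: real)"
      by (simp only: of_bool_conj)
  qed
  also have "\<dots> = bern p (\<Union>\<D>) (\<lambda>D. of_bool (\<forall>K\<in>\<D>. card (D \<inter> K) < d)) * bern p K (\<lambda>E. of_bool (card E < d))"
    by (simp only: bern_cmult_right bern_cmult)
  also have "\<dots> \<le> (1 - q) ^ card \<D> * (1 - q)"
  proof (rule mult_mono)
    show "bern p (\<Union>\<D>) (\<lambda>D. of_bool (\<forall>K\<in>\<D>. card (D \<inter> K) < d)) \<le> (1 - q) ^ card \<D>"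
      using insert by (auto simp: pairwise_insert)
    have "bern p K (\<lambda>E. of_bool (card E < d)) = bern p K (\<lambda>E. 1 - of_bool (d \<le> card E))"
      by (rule bern_cong) (auto simp: not_le)
    also have "\<dots> = 1 - bern p K (\<lambda>E. of_bool (d \<le> card E))" using fK by (simp add: bern_diff)
    finally show "bern p K (\<lambda>E. of_bool (card E < d)) \<le> 1 - q"
      using insert.prems(3)[of K] by simp
  qed (use p q1 in \<open>auto intro: bern_nonneg\<close>)
  finally show ?case using insert.hyps by (simp add: mult.commute)
qed

text \<open>Joining \<open>v\<close> to disjoint vertex sets gives disjoint edge sets, so the
  product bound applies; edges from \<open>v\<close> to vertices outside the family integrate
  out.\<close>

lemma bern_star_all_small_le:
  fixes v :: 'a
  assumes "finite U" "v \<notin> U" "pairwise disjnt \<D>" "\<And>K. K \<in> \<D> \<Longrightarrow> K \<subseteq> U \<and> card K = k" "finite \<D>"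
    and q: "\<And>A :: 'a set set. finite A \<Longrightarrow> card A = k \<Longrightarrow> q \<le> bern p A (\<lambda>E. of_bool (d \<le> card E))"
    and p: "0 \<le> p" "p \<le> 1" and q1: "q \<le> 1"
  shows "bern p ((\<lambda>w. {v, w}) ` U) (\<lambda>E. of_bool (\<forall>K\<in>\<D>. card (E \<inter> (\<lambda>w. {v, w}) ` K) < d)) \<le> (1 - q) ^ card \<D>"
proof -
  define s where "s K = (\<lambda>w. {v, w}) ` K" for K
  have inj: "inj s" unfolding s_def
    by (intro injI) (simp add: inj_image_eq_iff[OF inj_on_star])
  have fin: "finite K" if "K \<in> \<D>" for K using assms(1,4) that finite_subset by blast
  have "bern p (s U) (\<lambda>E. of_bool (\<forall>K\<in>\<D>. card (E \<inter> s K) < d)) =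
      bern p (\<Union>(s ` \<D>)) (\<lambda>E. of_bool (\<forall>K\<in>\<D>. card (E \<inter> s K) < d))"
  proof (rule bern_local)
    show "finite (s U)" using assms(1) by (simp add: s_def)
    show "\<Union>(s ` \<D>) \<subseteq> s U" using assms(4) by (auto simp: s_def)
    fix E
    have eq: "E \<inter> s K = E \<inter> \<Union>(s ` \<D>) \<inter> s K" if "K \<in> \<D>" for K using that by blast
    show "of_bool (\<forall>K\<in>\<D>. card (E \<inter> s K) < d) = (of_bool (\<forall>K\<in>\<D>. card (E \<inter> \<Union>(s ` \<D>) \<inter> s K) < d) :: real)"
      by (intro arg_cong[where f = of_bool] ball_cong refl) (simp only: eq)
  qed
  also have "\<dots> = bern p (\<Union>(s ` \<D>)) (\<lambda>E. of_bool (\<forall>A\<in>s ` \<D>. card (E \<inter> A) < d))" by simp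
  also have "\<dots> \<le> (1 - q) ^ card (s ` \<D>)"
  proof (rule bern_all_small_le)
    show "pairwise disjnt (s ` \<D>)"
    proof (rule pairwise_imageI)
      fix K L assume "K \<in> \<D>" "L \<in> \<D>" "K \<noteq> L"
      then have "K \<inter> L = {}" using assms(3) by (auto simp: pairwise_def disjnt_def)
      then show "disjnt (s K) (s L)"
        unfolding disjnt_def s_def by (simp add: image_Int[OF inj_on_star, symmetric])
    qed
    fix A assume "A \<in> s ` \<D>"
    then obtain K where K: "K \<in> \<D>" "A = s K" by blast
    show "finite A" using K fin by (simp add: s_def)
    moreover have "card A = k" using K assms(4) by (simp add: s_def card_image inj_on_star)
    ultimately show "q \<le> bern p A (\<lambda>E. of_bool (d \<le> card E))" by (rule q)
  qed (use assms in auto)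
  also have "card (s ` \<D>) = card \<D>" by (rule card_image) (rule inj_on_subset[OF inj subset_UNIV])
  finally show ?thesis by (simp add: s_def)
qed

lemma attached_chordal:
  fixes E :: "nat set set"
  assumes disj: "pairwise disjnt \<D>" and fin: "finite \<D>"
    and \<D>: "\<And>K. K \<in> \<D> \<Longrightarrow> K \<subseteq> {1..m} \<and> clique E K"
    and G: "finite G" "\<And>v. v \<in> G \<Longrightarrow> m < v"
    and att: "\<And>v. v \<in> G \<Longrightarrow> \<exists>K\<in>\<D>. d \<le> card (E \<inter> (\<lambda>w. {v, w}) ` K)"
  shows "\<exists>F\<subseteq>E. chordal F \<and> card G * d \<le> card F"
proof -
  obtain K where K: "\<And>v. v \<in> G \<Longrightarrow> K v \<in> \<D> \<and> d \<le> card (E \<inter> (\<lambda>w. {v, w}) ` K v)"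
    using bchoice[of G "\<lambda>v K. K \<in> \<D> \<and> d \<le> card (E \<inter> (\<lambda>w. {v, w}) ` K)"] att by blast
  define att where "att v = E \<inter> (\<lambda>w. {v, w}) ` K v" for v
  define F where "F = \<Union>(pairs ` \<D>) \<union> \<Union>(att ` G)"
  have KV: "w \<le> m" if "v \<in> G" "w \<in> K v" for v w
    using K[OF that(1)] \<D>[of "K v"] that(2) by auto
  have edge: "v \<in> G \<and> x \<in> K v \<or> (\<exists>L\<in>\<D>. v \<in> L \<and> x \<in> L)" if vx: "{v, x} \<in> F" "x < v" for v x
  proof -
    consider L where "L \<in> \<D>" "{v, x} \<in> pairs L" | u w where "u \<in> G" "w \<in> K u" "{v, x} = {u, w}"
      using vx(1) unfolding F_def att_def by blast
    then show ?thesis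
    proof cases
      case 1
      then show ?thesis by auto
    next
      case 2
      then have "w < u" using KV[of u w] G(2)[of u] by simp
      then have "v = u" "x = w" using 2(3) vx(2) by (auto simp: doubleton_eq_iff)
      then show ?thesis using 2 by simp
    qed
  qed
  have "chordal F"
  proof (rule chordal_if_ordered)
    fix v x y assume *: "{v, x} \<in> F" "{v, y} \<in> F" "x < v" "y < v" "x \<noteq> y"
    have "\<exists>L\<in>\<D>. x \<in> L \<and> y \<in> L"
    proof (cases "v \<in> G")
      case True
      then have "v \<notin> L" if "L \<in> \<D>" for L using G(2) \<D>[OF that] by force
      then have "x \<in> K v" "y \<in> K v" using edge[OF *(1,3)] edge[OF *(2,4)] by blast+
      then show ?thesis using K[OF True] by blast
    next
      case False
      then obtain L L' where L: "L \<in> \<D>" "v \<in> L" "x \<in> L" "L' \<in> \<D>" "v \<in> L'" "y \<in> L'"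
        using edge[OF *(1,3)] edge[OF *(2,4)] by blast
      then have "L = L'" using disj unfolding pairwise_def disjnt_def by blast
      then show ?thesis using L by blast
    qed
    then show "{x, y} \<in> F" using *(5) unfolding F_def by auto
  qed
  moreover have "F \<subseteq> E"
    using \<D> by (auto simp: F_def att_def clique_iff_pairs)
  moreover have "card G * d \<le> card F"
  proof -
    have fin_att: "finite (att v)" if "v \<in> G" for v
    proof -
      have "finite (K v)" using K[OF that] \<D>[of "K v"] finite_subset by blast
      then show ?thesis by (simp add: att_def)
    qed
    have "finite L" if "L \<in> \<D>" for L using \<D>[OF that] finite_subset by blast
    then have fF: "finite F"
      using fin G(1) fin_att unfolding F_def by auto
    have "card G * d = (\<Sum>v\<in>G. d)" by simp
    also have "\<dots> \<le> (\<Sum>v\<in>G. card (att v))" using K by (intro sum_mono) (simp add: att_def)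
    also have "\<dots> = card (\<Union>(att ` G))"
    proof (rule card_UN_disjoint[symmetric])
      show "\<forall>i\<in>G. \<forall>j\<in>G. i \<noteq> j \<longrightarrow> att i \<inter> att j = {}"
      proof (intro ballI impI)
        fix i j assume ij: "i \<in> G" "j \<in> G" "i \<noteq> j"
        then have "i \<notin> K j" "j \<notin> K i" using KV G(2) by force+
        then show "att i \<inter> att j = {}" using ij(3) by (auto simp: att_def doubleton_eq_iff)
      qed
    qed (use G fin_att in auto)
    also have "\<dots> \<le> card F" using fF by (intro card_mono) (auto simp: F_def)
    finally show ?thesis .
  qed
  ultimately show ?thesis by blast
qed

text \<open>Whether \<open>v > m\<close> can be attached is independent of the edges inside \<open>{1..m}\<close>, hence of the chosen
  family of disjoint cliques.\<close>
lemma lower_tail_le: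
  fixes q \<omega> a p :: real
  assumes p: "0 < p" "p \<le> 1" and k: "1 \<le> k" "k \<le> m" and m: "m \<le> n" and \<omega>: "0 < \<omega>" and a: "0 < a"
    and small: "\<And>i. 2 \<le> i \<Longrightarrow> i \<le> k \<Longrightarrow> overlap_weight p m k i \<le> 1 / m"
    and q: "\<And>A :: nat set set. finite A \<Longrightarrow> card A = k \<Longrightarrow> q \<le> bern p A (\<lambda>E. of_bool (d \<le> card E))"
    and q01: "0 \<le> q" "q \<le> 1"
  shows "bern p (all_pairs n) (\<lambda>E. of_bool (\<not> (\<exists>F\<subseteq>E. chordal F \<and> (real n - real m - a) * d \<le> card F)))
    \<le> 8 * (real k)\<^sup>2 / m + 1 / \<omega> + n * exp (- (q * (m / (32 * \<omega> * (real k)\<^sup>2)))) / a"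
proof -
  define V where "V = {1..m}"
  define N where "N = real m / (32 * \<omega> * (real k)\<^sup>2)"
  have fV: "finite V" and VA: "pairs V \<subseteq> all_pairs n"
    using m by (auto simp: V_def all_pairs_eq intro!: pairs_mono)
  define pack where "pack E \<D> \<longleftrightarrow> pairwise disjnt \<D> \<and> finite \<D> \<and>
      (\<forall>K\<in>\<D>. K \<subseteq> V \<and> card K = k \<and> clique E K) \<and> N \<le> card \<D>" for E \<D>
  \<comment> \<open>A fixed choice of the family as a function of the edges inside \<open>V\<close>,
    so that conditioning on these edges makes the family deterministic.\<close>
  define fam where "fam E = (SOME \<D>. pack E \<D>)" for E
  define ok where "ok E \<longleftrightarrow> (\<exists>\<D>. pack E \<D>)" for E
  have fam: "pack E (fam E)" if "ok E" for E
    using that unfolding ok_def fam_def by (rule someI_ex)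
  define W where "W = {m<..n}"
  define star where "star v = (\<lambda>w. {v, w}) ` V" for v
  \<comment> \<open>Existence of a packing is part of the event, because otherwise
    \<open>fam\<close> is an arbitrary value.\<close>
  define bad where "bad v E \<longleftrightarrow> ok (E \<inter> pairs V) \<and>
      (\<forall>K\<in>fam (E \<inter> pairs V). card (E \<inter> (\<lambda>w. {v, w}) ` K) < d)" for v E
  have bad_le: "bern p (all_pairs n) (\<lambda>E. of_bool (bad v E)) \<le> exp (- (q * N))" if v: "v \<in> W" for v
  proof -
    have vV: "v \<notin> V" using v by (auto simp: W_def V_def)
    have disj: "pairs V \<inter> star v = {}" using vV by (simp add: star_def pairs_Un_star_disjoint)
    have famV: "K \<subseteq> V" if "ok E" "K \<in> fam E" for K E using fam[OF that(1)] that(2) by (auto simp: pack_def)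
    have "bern p (all_pairs n) (\<lambda>E. of_bool (bad v E)) = bern p (pairs V \<union> star v) (\<lambda>E. of_bool (bad v E))"
    proof (rule bern_local)
      show "pairs V \<union> star v \<subseteq> all_pairs n"
        using VA v vV m by (auto simp: all_pairs_eq star_def W_def V_def)
      fix E
      have 1: "E \<inter> (pairs V \<union> star v) \<inter> pairs V = E \<inter> pairs V" by blast
      have 2: "E \<inter> (pairs V \<union> star v) \<inter> (\<lambda>w. {v, w}) ` K = E \<inter> (\<lambda>w. {v, w}) ` K" if "K \<subseteq> V" for K
        using that by (auto simp: star_def)
      have "bad v (E \<inter> (pairs V \<union> star v)) \<longleftrightarrow> bad v E"
        unfolding bad_def 1 using 2 famV by (metis (no_types, lifting))
      then show "of_bool (bad v E) = (of_bool (bad v (E \<inter> (pairs V \<union> star v))) :: real)" by simp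
    qed simp
    also have "\<dots> = bern p (pairs V) (\<lambda>E. bern p (star v) (\<lambda>D. of_bool (bad v (E \<union> D))))"
      using fV disj by (intro bern_Un) (auto simp: star_def)
    also have "\<dots> \<le> bern p (pairs V) (\<lambda>E. exp (- (q * N)))"
    proof (rule bern_mono)
      fix E assume E: "E \<subseteq> pairs V"
      show "bern p (star v) (\<lambda>D. of_bool (bad v (E \<union> D))) \<le> exp (- (q * N))"
      proof (cases "ok E")
        case True
        note P = fam[OF True, unfolded pack_def]
        have "bern p (star v) (\<lambda>D. of_bool (bad v (E \<union> D))) =
          bern p (star v) (\<lambda>D. of_bool (\<forall>K\<in>fam E. card (D \<inter> (\<lambda>w. {v, w}) ` K) < d))"
        proof (rule bern_cong)
          fix D assume D: "D \<subseteq> star v"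
          have 1: "(E \<union> D) \<inter> pairs V = E" using E D disj by blast
          have "E \<inter> (\<lambda>w. {v, w}) ` K = {}" for K
            using E vV by auto
          then have 2: "(E \<union> D) \<inter> (\<lambda>w. {v, w}) ` K = D \<inter> (\<lambda>w. {v, w}) ` K" for K by (simp add: Int_Un_distrib2)
          show "of_bool (bad v (E \<union> D)) = (of_bool (\<forall>K\<in>fam E. card (D \<inter> (\<lambda>w. {v, w}) ` K) < d) :: real)"
            unfolding bad_def 1 2 using True by simp
        qed
        also have "\<dots> \<le> (1 - q) ^ card (fam E)"
          unfolding star_def using P fV vV q p q01 by (intro bern_star_all_small_le[where k = k]) auto
        also have "\<dots> \<le> exp (- q) ^ card (fam E)"
          using q01 exp_ge_add_one_self[of "- q"] by (intro power_mono) auto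
        also have "\<dots> = exp (- (card (fam E) * q))" by (simp add: exp_of_nat_mult[symmetric])
        also have "\<dots> \<le> exp (- (q * N))"
          using P q01 by (simp add: mult.commute[of q] mult_right_mono)
        finally show ?thesis .
      next
        case False
        have "bern p (star v) (\<lambda>D. of_bool (bad v (E \<union> D))) = bern p (star v) (\<lambda>D. 0)"
        proof (rule bern_cong)
          fix D assume D: "D \<subseteq> star v"
          have 1: "(E \<union> D) \<inter> pairs V = E" using E D disj by blast
          show "of_bool (bad v (E \<union> D)) = (0::real)" unfolding bad_def 1 using False by simp
        qed
        then show ?thesis using fV by (simp add: star_def)
      qed
    qed (use p in auto)
    also have "\<dots> = exp (- (q * N))" using fV by simp
    finally show ?thesis .
  qed
  define Y where "Y E = (\<Sum>v\<in>W. of_bool (bad v E) :: real)" for E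
  let ?conc = "\<lambda>E. \<exists>F\<subseteq>E. chordal F \<and> (real n - real m - a) * d \<le> card F"
  have conc: "?conc E" if okE: "\<not> \<not> ok (E \<inter> pairs V)" and Y: "\<not> a \<le> Y E" for E
  proof -
    define \<D> where "\<D> = fam (E \<inter> pairs V)"
    have P: "pack (E \<inter> pairs V) \<D>" using fam okE by (simp add: \<D>_def)
    define G where "G = {v \<in> W. \<not> bad v E}"
    have "card {v \<in> W. bad v E} = Y E"
      unfolding Y_def by (simp add: of_bool_def sum.If_cases Int_def W_def)
    moreover have "card W = card G + card {v \<in> W. bad v E}"
    proof -
      have "W = G \<union> {v \<in> W. bad v E}" by (auto simp: G_def)
      moreover have "card (G \<union> {v \<in> W. bad v E}) = card G + card {v \<in> W. bad v E}"
        by (rule card_Un_disjoint) (auto simp: G_def W_def)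
      ultimately show ?thesis by simp
    qed
    moreover have "card W = n - m" by (simp add: W_def)
    ultimately have cG: "real n - real m - a \<le> card G" using Y m by linarith
    have "\<exists>F\<subseteq>E. chordal F \<and> card G * d \<le> card F"
    proof (rule attached_chordal[of \<D> m])
      show "K \<subseteq> {1..m} \<and> clique E K" if "K \<in> \<D>" for K
        using P that by (auto simp: pack_def V_def clique_def)
      show "\<exists>K\<in>\<D>. d \<le> card (E \<inter> (\<lambda>w. {v, w}) ` K)" if "v \<in> G" for v
        using that okE by (auto simp: G_def bad_def \<D>_def not_less)
    qed (use P in \<open>auto simp: pack_def G_def W_def\<close>)
    then obtain F where F: "F \<subseteq> E" "chordal F" "card G * d \<le> card F" by blast
    have "(real n - real m - a) * d \<le> real (card G) * d" using cG by (intro mult_right_mono) auto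
    also have "\<dots> \<le> card F" using F(3) by (metis of_nat_le_iff of_nat_mult)
    finally show ?thesis using F by blast
  qed
  have "bern p (all_pairs n) (\<lambda>E. of_bool (\<not> ?conc E)) \<le>
    bern p (all_pairs n) (\<lambda>E. of_bool (\<not> ok (E \<inter> pairs V)) + of_bool (a \<le> Y E))"
  proof (rule bern_mono)
    fix E
    have key: "of_bool (\<not> P) \<le> (of_bool A + of_bool B :: real)" if "\<not> A \<Longrightarrow> \<not> B \<Longrightarrow> P" for P A B
      using that by (cases P; cases A; cases B) auto
    show "of_bool (\<not> ?conc E) \<le> (of_bool (\<not> ok (E \<inter> pairs V)) + of_bool (a \<le> Y E) :: real)"
      by (rule key) (rule conc)
  qed (use p in auto)
  also have "\<dots> = bern p (all_pairs n) (\<lambda>E. of_bool (\<not> ok (E \<inter> pairs V))) + bern p (all_pairs n) (\<lambda>E. of_bool (a \<le> Y E))"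
    by (rule bern_add)
  also have "bern p (all_pairs n) (\<lambda>E. of_bool (\<not> ok (E \<inter> pairs V))) = bern p (pairs V) (\<lambda>E. of_bool (\<not> ok (E \<inter> pairs V)))"
    using VA by (intro bern_local) (auto simp: Int_assoc)
  also have "\<dots> = bern p (pairs V) (\<lambda>E. of_bool (\<not> ok E))"
    by (rule bern_cong) (simp add: inf.absorb1)
  also have "\<dots> \<le> 8 * (real k)\<^sup>2 / m + 1 / \<omega>"
    using prob_no_clique_packing_le[OF p fV _ k \<omega> small] by (simp add: ok_def pack_def N_def V_def)
  also have "bern p (all_pairs n) (\<lambda>E. of_bool (a \<le> Y E)) \<le> bern p (all_pairs n) Y / a"
    using p a by (intro bern_markov) (auto simp: Y_def sum_nonneg)
  also have "bern p (all_pairs n) Y \<le> n * exp (- (q * N))"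
  proof -
    have "bern p (all_pairs n) Y = (\<Sum>v\<in>W. bern p (all_pairs n) (\<lambda>E. of_bool (bad v E)))"
      unfolding Y_def[abs_def] by (rule bern_sum)
    also have "\<dots> \<le> (\<Sum>v\<in>W. exp (- (q * N)))" using bad_le by (intro sum_mono)
    also have "\<dots> \<le> n * exp (- (q * N))" by (simp add: W_def)
    finally show ?thesis .
  qed
  finally show ?thesis using a by (simp add: N_def divide_right_mono)
qed


section \<open>The lower bound\<close>

text \<open>Convexity: the quadratic in \<open>i\<close> has leading coefficient
  \<open>b / 2 \<ge> 0\<close>, so on the interval from 2 to \<open>k\<close> it is largest at an
  endpoint.\<close>

lemma quadratic_endpoints_le:
  fixes A b T i k :: real
  assumes "0 \<le> b" "2 \<le> i" "i \<le> k"
    and "2 * A + b \<le> T" "k * A + k * (k - 1) / 2 * b \<le> T"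
  shows "i * A + i * (i - 1) / 2 * b \<le> T"
proof (cases "k = 2")
  case True
  then show ?thesis using assms by simp
next
  case False
  then have k: "0 < k - 2" using assms by simp
  have "(k - 2) * (i * A + i * (i - 1) / 2 * b) =
      (k - i) * (2 * A + b) + (i - 2) * (k * A + k * (k - 1) / 2 * b) - (b / 2) * ((i - 2) * (k - i) * (k - 2))"
    by (simp add: field_simps)
  also have "\<dots> \<le> (k - i) * T + (i - 2) * T - 0"
    using assms by (intro diff_mono add_mono mult_left_mono mult_nonneg_nonneg) auto
  also have "\<dots> = (k - 2) * T" by (simp add: algebra_simps)
  finally show ?thesis using k by (simp add: mult_le_cancel_left)
qed

text \<open>The parameters are \<open>m\<close> about \<open>n / y\<close>, \<open>k\<close> about
  \<open>2 * y / b - 10 * ln y / b\<close>, the factor \<open>sqrt y\<close> in Markov's inequality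
  for the overlaps, and an allowance of \<open>n / y\<close> unattached vertices. The subtraction in
  \<open>k\<close> makes \<open>exp (- k * b / 2)\<close> at least \<open>y^5 / n\<close>. A factor
  of order \<open>y\<close> is lost at the binomial mode and the family has order
  \<open>n / y^(7/2)\<close> cliques, so a vertex still expects order \<open>sqrt y\<close> suitable
  ones.\<close>

lemma lower_tail_explicit:
  fixes p x b y \<tau> :: real
  assumes p: "0 < p" "p < 1" and x: "p < x" "x < 1" "bin_KL x p = b / 2"
    and b: "b = ln (1 / p)" and y: "y = ln (real n)" and \<tau>: "\<tau> = tilt x p powr x"
    and H1: "2 \<le> y" and H2: "1 / x + 1 \<le> 2 * y / b - 10 * ln y / b" and H3: "2 * y \<le> n"
    and H4: "2 * y / b \<le> n / (2 * y)" and H5: "(2 * y / b) ^ 4 / p * (2 * y) \<le> n"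
    and H6: "ln (8 / b\<^sup>2) - 2 * ln y \<le> - b" and H7: "10 * ln y + b \<le> y"
    and H8: "1 + 4 * x / b \<le> 10 * (ln y / b) * (1 - x)" and H9: "1 \<le> y / b"
  shows "bern p (all_pairs n) (\<lambda>E. of_bool (\<not> (\<exists>F\<subseteq>E. chordal F \<and>
      2 * x * n * (y / b) - 10 * real n * (ln y / b) \<le> card F)))
    \<le> 64 * y ^ 3 / (b\<^sup>2 * n) + 1 / sqrt y + y * exp (- (b ^ 3 / (768 * \<tau>) * sqrt y))"
proof -
  have b0: "0 < b" using p by (simp add: b)
  have x0: "0 < x" using p x by simp
  have y0: "0 < y" "1 < y" using H1 by auto
  have ly0: "0 < ln y" using y0 by simp
  have n0: "0 < real n" using H1 H3 by simp
  have ey: "exp y = n" using n0 by (simp add: y)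
  have \<tau>1: "1 \<le> \<tau>" using tilt_gt_1[of p x] p x x0 by (simp add: \<tau> ge_one_powr_ge_zero)
  define R where "R = 2 * y / b - 10 * ln y / b"
  define k where "k = nat \<lfloor>R\<rfloor>"
  define m where "m = nat \<lfloor>n / y\<rfloor>"
  define d where "d = nat \<lfloor>(real k + 1) * x\<rfloor>"
  define q where "q = exp (- (k * bin_KL x p)) / ((real k + 1) * \<tau>)"
  have "1 \<le> 1 / x" using x x0 by simp
  then have R: "2 \<le> R" using H2 by (simp add: R_def)
  have k: "real k \<le> R" "R - 1 \<le> k" "2 \<le> k" using R unfolding k_def by linarith+
  have kR: "R \<le> real k + 1" using k by simp
  have kb: "real k \<le> 2 * y / b"
  proof -
    have "0 \<le> 10 * ln y / b" using ly0 b0 by simp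
    then show ?thesis using k(1) unfolding R_def by linarith
  qed
  have kb': "real k * b \<le> 2 * y - 10 * ln y" 
    using k(1) b0 by (simp add: R_def field_simps)
  have ny: "2 \<le> real n / y" using H3 y0 by (simp add: field_simps)
  have m: "real m \<le> n / y" "n / (2 * y) \<le> m"
  proof -
    show "real m \<le> n / y" using ny unfolding m_def by linarith
    have "n / (2 * y) \<le> n / y - 1" using ny by simp
    then show "n / (2 * y) \<le> m" using ny unfolding m_def by linarith
  qed
  have "0 < n / (2 * y)" using n0 y0 by simp
  then have m0: "0 < real m" using m(2) by linarith
  have km: "k \<le> m" using kb m(2) H4 by linarith
  have mn: "m \<le> n"
  proof -
    have "n / y \<le> n" using y0 n0 by (simp add: field_simps)
    then show ?thesis using m(1) by linarith
  qed
  have k2m: "(real k)\<^sup>2 / m \<le> 8 * y ^ 3 / (b\<^sup>2 * n)"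
  proof -
    have "(real k)\<^sup>2 / m \<le> (2 * y / b)\<^sup>2 / (n / (2 * y))"
      using kb m n0 y0 m0 by (intro frac_le power_mono) auto
    also have "\<dots> = 8 * y ^ 3 / (b\<^sup>2 * n)"
      using y0 n0 b0 by (simp add: field_simps power2_eq_square power3_eq_cube)
    finally show ?thesis .
  qed
  have small: "overlap_weight p m k i \<le> 1 / m" if i: "2 \<le> i" "i \<le> k" for i
  proof -
    define A where "A = ln ((real k)\<^sup>2 / m)"
    have kk: "0 < (real k)\<^sup>2 / m" using k m0 by simp
    have ow: "overlap_weight p m k j = exp (real j * A + real j * (real j - 1) / 2 * b)" for j
    proof -
      have "real (j choose 2) = real j * (real j - 1) / 2"
      proof -
        have "2 * (j choose 2) = j * (j - 1)"
        proof (cases j)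
          case (Suc i)
          then show ?thesis using choose_two[of "Suc i"] by simp
        qed simp
        then have "2 * real (j choose 2) = real j * real (j - 1)" by (metis of_nat_mult of_nat_numeral)
        then show ?thesis by (cases j) auto
      qed
      moreover have "(1 / p) ^ (j choose 2) = exp (real (j choose 2) * b)"
        using p by (simp add: b exp_of_nat_mult)
      moreover have "(real (k * k) / real m) ^ j = exp (real j * A)"
        using kk by (simp add: A_def exp_of_nat_mult power2_eq_square)
      ultimately show ?thesis by (simp add: overlap_weight_def exp_add)
    qed
    \<comment> \<open>At \<open>i = 2\<close> the weight is \<open>k^4 / (p * m^2)\<close>, and
      \<open>m\<close> exceeds every fixed power of \<open>y\<close>.\<close>
    have end2: "2 * A + b \<le> - ln m"
    proof -
      have "(real k) ^ 4 / p \<le> (2 * y / b) ^ 4 / p"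
        using kb p by (intro divide_right_mono power_mono) auto
      also have "\<dots> \<le> n / (2 * y)" using H5 y0 by (simp add: field_simps)
      also have "\<dots> \<le> m" by (rule m(2))
      finally have "ln ((real k) ^ 4 / p) \<le> ln m" using k p m0 by (intro ln_mono) auto
      moreover have "ln ((real k) ^ 4 / p) = 4 * ln k + b"
        using k p by (simp add: ln_div ln_realpow b)
      moreover have "A = 2 * ln k - ln m" using k m0 by (simp add: A_def ln_div ln_realpow)
      ultimately show ?thesis by simp
    qed
    have endk: "real k * A + real k * (real k - 1) / 2 * b \<le> - ln m"
    proof -
      have "A \<le> ln (8 * y ^ 3 / (b\<^sup>2 * n))" unfolding A_def using k2m kk by (intro ln_mono) auto
      also have "8 * y ^ 3 / (b\<^sup>2 * n) = (8 / b\<^sup>2) * y ^ 3 / n" by simp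
      also have "ln \<dots> = ln (8 / b\<^sup>2) + 3 * ln y - y"
        using b0 y0 n0 by (simp add: ln_div ln_mult ln_realpow y[symmetric] del: times_divide_eq_left times_divide_eq_right)
      finally have "A \<le> ln (8 / b\<^sup>2) + 3 * ln y - y" .
      moreover have "(real k - 1) / 2 * b \<le> y - 5 * ln y"
        using kb' b0 by (simp add: field_simps)
      \<comment> \<open>The \<open>5 * ln y\<close> saved by shortening the cliques beats the
        \<open>3 * ln y\<close> from \<open>k^2 / m\<close>; the remaining \<open>2 * ln y\<close>
        absorbs the constants.\<close>
      ultimately have "A + (real k - 1) / 2 * b \<le> - b" using H6 by linarith
      then have "real k * (A + (real k - 1) / 2 * b) \<le> real k * (- b)" by (intro mult_left_mono) auto
      also have "\<dots> \<le> - y"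
      proof -
        have "(R - 1) * b \<le> real k * b" using k b0 by (intro mult_right_mono) auto
        moreover have "(R - 1) * b = 2 * y - 10 * ln y - b" using b0 by (simp add: R_def field_simps)
        ultimately show ?thesis using H7 by simp
      qed
      also have "\<dots> \<le> - ln m"
      proof -
        have "ln (real m) \<le> ln (real n)" using mn m0 by (intro ln_mono) auto
        then show ?thesis by (simp add: y)
      qed
      finally show ?thesis by (simp add: algebra_simps)
    qed
    have "real i * A + real i * (real i - 1) / 2 * b \<le> - ln m"
      by (rule quadratic_endpoints_le[OF _ _ _ end2 endk]) (use i b0 in simp_all)
    then have "overlap_weight p m k i \<le> exp (- ln (real m))" unfolding ow by simp
    then show ?thesis using m0 by (simp add: exp_minus inverse_eq_divide)
  qed
  have q01: "0 \<le> q" "q \<le> 1"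
  proof -
    show "0 \<le> q" using \<tau>1 by (simp add: q_def)
    have "1 * 1 \<le> (real k + 1) * \<tau>" using \<tau>1 by (intro mult_mono) auto
    moreover have "exp (- (k * bin_KL x p)) \<le> 1" using x(3) b0 by simp
    ultimately have "exp (- (k * bin_KL x p)) \<le> (real k + 1) * \<tau>" "0 < (real k + 1) * \<tau>"
      by linarith+
    then show "q \<le> 1" unfolding q_def by (simp only: divide_le_eq_1_pos)
  qed
  have q: "q \<le> bern p A (\<lambda>E. of_bool (d \<le> card E))" if "finite A" "card A = k" for A :: "nat set set"
    unfolding q_def \<tau> using binomial_tail_ge[OF p(1) x(1,2) that d_def] .
  have sq0: "0 < sqrt y" using y0 by simp
  note main = lower_tail_le[of p k m n "sqrt y" "n / y" q d, OF p(1) _ _ km mn sq0 _ small q q01]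
  have qN: "b ^ 3 / (768 * \<tau>) * sqrt y \<le> q * (m / (32 * sqrt y * (real k)\<^sup>2))"
  proof -
    have "y ^ 5 / n \<le> exp (- (k * bin_KL x p))"
    proof -
      have "real k * bin_KL x p \<le> y - 5 * ln y" using kb' by (simp add: x(3))
      then have "exp (5 * ln y - y) \<le> exp (- (k * bin_KL x p))" by simp
      moreover have "exp (5 * ln y) = y ^ 5" using y0 exp_of_nat_mult[of 5 "ln y"] by simp
      ultimately show ?thesis by (simp add: exp_diff ey)
    qed
    moreover have "real k + 1 \<le> 3 * y / b" using kb H9 by simp
    ultimately have q1: "y ^ 5 / n / (3 * y / b * \<tau>) \<le> q"
      unfolding q_def using \<tau>1 y0 by (intro frac_le mult_right_mono) auto
    have N1: "n / (2 * y) / (32 * sqrt y * (2 * y / b)\<^sup>2) \<le> m / (32 * sqrt y * (real k)\<^sup>2)"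
      using m kb k y0 n0 by (intro frac_le mult_left_mono power_mono) auto
    have "b ^ 3 / (768 * \<tau>) * sqrt y = y ^ 5 / n / (3 * y / b * \<tau>) * (n / (2 * y) / (32 * sqrt y * (2 * y / b)\<^sup>2))"
    proof -
      define r where "r = sqrt y"
      have "0 < r" "y = r\<^sup>2" using y0 by (auto simp: r_def)
      then show ?thesis unfolding r_def[symmetric] using b0 n0 \<tau>1
        by (simp add: field_simps eval_nat_numeral)
    qed
    also have "\<dots> \<le> q * (m / (32 * sqrt y * (real k)\<^sup>2))"
      using q1 N1 q01 y0 n0 b0 by (intro mult_mono) auto
    finally show ?thesis .
  qed
  have T: "2 * x * n * (y / b) - 10 * real n * (ln y / b) \<le> (real n - real m - n / y) * d"
  proof -
    define L where "L = y / b"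
    define lam where "lam = ln y / b"
    have RL: "R = 2 * L - 10 * lam" by (simp add: R_def L_def lam_def)
    have lam0: "0 \<le> lam" using ly0 b0 by (simp add: lam_def)
    have "R * x \<le> (real k + 1) * x" using kR x0 by (intro mult_right_mono) auto
    then have d1: "R * x - 1 \<le> d" unfolding d_def by linarith
    have d0: "0 \<le> R * x - 1"
    proof -
      have "1 / x * x \<le> R * x" using H2 x0 by (intro mult_right_mono) (auto simp: R_def)
      then show ?thesis using x0 by simp
    qed
    have frac: "real n * (1 - 2 / y) \<le> real n - real m - n / y" using m(1) by (simp add: algebra_simps)
    \<comment> \<open>Shortening the cliques costs \<open>10 * lam * x\<close> per vertex. The other
      \<open>10 * lam * (1 - x)\<close> pays for rounding \<open>d\<close> and for the at most
      \<open>2 * n / y\<close> vertices that host the cliques or remain unattached.\<close>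
    have "2 * x * L - 10 * lam \<le> (R * x - 1) - (2 / y) * (2 * L * x)"
    proof -
      have "(2 / y) * (2 * L * x) = 4 * x / b" using y0 by (simp add: L_def)
      moreover have "1 + 4 * x / b \<le> 10 * lam - 10 * lam * x" using H8[folded lam_def] by (simp add: right_diff_distrib)
      ultimately show ?thesis by (simp add: RL algebra_simps)
    qed
    also have "\<dots> \<le> (R * x - 1) - (2 / y) * (R * x - 1)"
    proof (intro diff_left_mono mult_left_mono)
      have "0 \<le> 10 * lam * x" using lam0 x0 by simp
      then show "R * x - 1 \<le> 2 * L * x" by (simp add: RL algebra_simps)
    qed (use y0 in auto)
    also have "\<dots> = (1 - 2 / y) * (R * x - 1)" by (simp add: algebra_simps)
    finally have "real n * (2 * x * L - 10 * lam) \<le> real n * ((1 - 2 / y) * (R * x - 1))"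
      by (intro mult_left_mono) auto
    also have "\<dots> = (real n * (1 - 2 / y)) * (R * x - 1)" by simp
    also have "\<dots> \<le> (real n - real m - n / y) * d"
    proof (rule mult_mono[OF frac d1])
      have "0 \<le> 1 - 2 / y" using H1 by simp
      then have "0 \<le> real n * (1 - 2 / y)" by (intro mult_nonneg_nonneg) auto
      then show "0 \<le> real n - real m - n / y" using frac by linarith
    qed (rule d0)
    finally show ?thesis by (simp add: L_def lam_def algebra_simps)
  qed
  have "bern p (all_pairs n) (\<lambda>E. of_bool (\<not> (\<exists>F\<subseteq>E. chordal F \<and>
      2 * x * n * (y / b) - 10 * real n * (ln y / b) \<le> card F))) \<le>
    bern p (all_pairs n) (\<lambda>E. of_bool (\<not> (\<exists>F\<subseteq>E. chordal F \<and> (real n - real m - n / y) * d \<le> card F)))"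
  proof (rule bern_mono)
    fix E :: "nat set set"
    have mono: "of_bool (\<not> P) \<le> (of_bool (\<not> Q) :: real)" if "Q \<Longrightarrow> P" for P Q
      using that by (cases P; cases Q) auto
    show "of_bool (\<not> (\<exists>F\<subseteq>E. chordal F \<and> 2 * x * n * (y / b) - 10 * real n * (ln y / b) \<le> card F))
      \<le> (of_bool (\<not> (\<exists>F\<subseteq>E. chordal F \<and> (real n - real m - n / y) * d \<le> card F)) :: real)"
      by (rule mono) (use T in \<open>blast intro: order_trans\<close>)
  qed (use p in auto)
  also have "\<dots> \<le> 8 * (real k)\<^sup>2 / m + 1 / sqrt y +
      n * exp (- (q * (m / (32 * sqrt y * (real k)\<^sup>2)))) / (n / y)"
    by (rule main) (use p k(3) n0 y0 in simp_all)
  also have "\<dots> \<le> 64 * y ^ 3 / (b\<^sup>2 * n) + 1 / sqrt y + y * exp (- (b ^ 3 / (768 * \<tau>) * sqrt y))"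
  proof (intro add_mono order_refl)
    show "8 * (real k)\<^sup>2 / m \<le> 64 * y ^ 3 / (b\<^sup>2 * n)" using k2m by simp
    have "n * exp (- (q * (m / (32 * sqrt y * (real k)\<^sup>2)))) / (n / y) =
      y * exp (- (q * (m / (32 * sqrt y * (real k)\<^sup>2))))" using n0 by simp
    also have "\<dots> \<le> y * exp (- (b ^ 3 / (768 * \<tau>) * sqrt y))"
      using qN y0 by (intro mult_left_mono) auto
    finally show "n * exp (- (q * (m / (32 * sqrt y * (real k)\<^sup>2)))) / (n / y)
      \<le> y * exp (- (b ^ 3 / (768 * \<tau>) * sqrt y))" .
  qed
  finally show ?thesis .
qed

lemma lower_tail_tendsto:
  fixes p x :: real
  assumes p: "0 < p" "p < 1" and x: "p < x" "x < 1" "bin_KL x p = ln (1 / p) / 2"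
  shows "(\<lambda>n. bern p (all_pairs n) (\<lambda>E. of_bool (\<not> (\<exists>F\<subseteq>E. chordal F \<and>
    2 * x * n * log (1 / p) (real n) - 10 * real n * log (1 / p) (ln (real n)) \<le> card F)))) \<longlonglongrightarrow> 0"
proof -
  define b where "b = ln (1 / p)"
  have b: "0 < b" using p by (auto simp: b_def)
  define \<tau> where "\<tau> = tilt x p powr x"
  have \<tau>: "0 < \<tau>" using tilt_gt_1[of p x] p x by (simp add: \<tau>_def)
  let ?B = "\<lambda>n. 64 * ln (real n) ^ 3 / (b\<^sup>2 * n) + 1 / sqrt (ln (real n)) +
    ln (real n) * exp (- (b ^ 3 / (768 * \<tau>) * sqrt (ln (real n))))"
  show ?thesis
  proof (rule tendsto_sandwich[of "\<lambda>_. 0" _ _ ?B])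
    define c where "c = ln (8 / b\<^sup>2)"
    define ix where "ix = 1 / x"
    define p' where "p' = 1 / p"
    define x' where "x' = 1 - x"
    have x': "0 < x'" using x by (simp add: x'_def)
    have "\<forall>\<^sub>F n in sequentially. 2 \<le> ln (real n)" by real_asymp
    moreover have "\<forall>\<^sub>F n in sequentially. ix + 1 \<le> 2 * ln (real n) / b - 10 * ln (ln (real n)) / b"
      using b by real_asymp
    moreover have "\<forall>\<^sub>F n in sequentially. 2 * ln (real n) \<le> n" by real_asymp
    moreover have "\<forall>\<^sub>F n in sequentially. 2 * ln (real n) / b \<le> n / (2 * ln (real n))"
      using b by real_asymp
    moreover have "\<forall>\<^sub>F n in sequentially. (2 * ln (real n) / b) ^ 4 * p' * (2 * ln (real n)) \<le> n"
      using b p by real_asymp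
    moreover have "\<forall>\<^sub>F n in sequentially. c - 2 * ln (ln (real n)) \<le> - b" by real_asymp
    moreover have "\<forall>\<^sub>F n in sequentially. 10 * ln (ln (real n)) + b \<le> ln (real n)" by real_asymp
    moreover have "\<forall>\<^sub>F n in sequentially. 1 + 4 * x / b \<le> 10 * (ln (ln (real n)) / b) * x'"
      using b x' by real_asymp
    moreover have "\<forall>\<^sub>F n in sequentially. 1 \<le> ln (real n) / b" using b by real_asymp
    ultimately show "\<forall>\<^sub>F n in sequentially. bern p (all_pairs n) (\<lambda>E. of_bool (\<not> (\<exists>F\<subseteq>E. chordal F \<and>
      2 * x * n * log (1 / p) (real n) - 10 * real n * log (1 / p) (ln (real n)) \<le> card F))) \<le> ?B n"
    proof eventually_elim
      case (elim n)
      then show ?case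
        using lower_tail_explicit[OF p x(1,2) _ b_def refl \<tau>_def, of n] x(3)
        by (simp add: log_def b_def[symmetric] c_def ix_def p'_def x'_def)
    qed
    show "?B \<longlonglongrightarrow> 0" using b \<tau> by real_asymp
    show "\<forall>\<^sub>F n in sequentially. 0 \<le> bern p (all_pairs n) (\<lambda>E. of_bool (\<not> (\<exists>F\<subseteq>E. chordal F \<and>
      2 * x * n * log (1 / p) (real n) - 10 * real n * log (1 / p) (ln (real n)) \<le> card F)))"
      using p by (intro always_eventually allI bern_nonneg) auto
  qed (rule tendsto_const)
qed

section \<open>Concentration of the maximum\<close>

lemma chordal_empty: "chordal {}"
  by (rule chordal_if_ordered) simp

lemma max_chordal_edges:
  assumes "finite E"
  shows "\<exists>F\<subseteq>E. chordal F \<and> card F = max_chordal_edges E"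
    and "F \<subseteq> E \<Longrightarrow> chordal F \<Longrightarrow> card F \<le> max_chordal_edges E"
proof -
  let ?S = "{card F | F. F \<subseteq> E \<and> chordal F}"
  have "?S = card ` {F. F \<subseteq> E \<and> chordal F}" by blast
  then have fin: "finite ?S" using assms by simp
  have "card ({} :: nat set set) \<in> ?S"
    using chordal_empty by (intro CollectI exI[of _ "{}"]) simp
  then have "Max ?S \<in> ?S" using fin by (intro Max_in) auto
  then show "\<exists>F\<subseteq>E. chordal F \<and> card F = max_chordal_edges E"
    unfolding max_chordal_edges_def by auto
  show "card F \<le> max_chordal_edges E" if "F \<subseteq> E" "chordal F"
    unfolding max_chordal_edges_def using fin that by (intro Max_ge) auto
qed

theorem theorem1:
  fixes p :: real
  assumes "0 < p" and "p < 1"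
  shows "(\<lambda>n. prob_Gnp n p (\<lambda>E.
            \<bar>real (max_chordal_edges E) - gamma p * real n * log (1 / p) (real n)\<bar>
              \<le> 10 * real n * log (1 / p) (ln (real n))))
         \<longlonglongrightarrow> 1"
proof -
  define x where "x = gamma p / 2"
  have x: "p < x" "x < 1" "bin_KL x p = ln (1 / p) / 2" and \<gamma>: "gamma p = 2 * x"
    using gamma_properties[OF assms] by (auto simp: x_def)
  let ?T = "\<lambda>n. 2 * x * real n * log (1 / p) (real n)" and ?D = "\<lambda>n. 10 * real n * log (1 / p) (ln (real n))"
  let ?up = "\<lambda>n E. \<exists>F\<subseteq>E. chordal F \<and> ?T n + ?D n < card F"
  let ?low = "\<lambda>n E. \<not> (\<exists>F\<subseteq>E. chordal F \<and> ?T n - ?D n \<le> card F)"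
  let ?ev = "\<lambda>n E. \<bar>real (max_chordal_edges E) - gamma p * real n * log (1 / p) (real n)\<bar> \<le> ?D n"
  define U where "U n = bern p (all_pairs n) (\<lambda>E. of_bool (?up n E))" for n
  define L where "L n = bern p (all_pairs n) (\<lambda>E. of_bool (?low n E))" for n
  have lim: "(\<lambda>n. 1 - (U n + L n)) \<longlonglongrightarrow> 1 - (0 + 0)"
    using upper_tail_tendsto[OF assms x] lower_tail_tendsto[OF assms x]
    unfolding U_def L_def by (intro tendsto_intros) simp_all
  have ev: "?ev n E" if E: "E \<subseteq> all_pairs n" and nup: "\<not> ?up n E" and nlow: "\<not> ?low n E" for n E
  proof -
    have fE: "finite E" using E by (rule finite_subset) simp
    obtain F where F: "F \<subseteq> E" "chordal F" "?T n - ?D n \<le> card F" using nlow by blast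
    have "card F \<le> max_chordal_edges E" using max_chordal_edges(2)[OF fE F(1,2)] .
    moreover have "max_chordal_edges E \<le> ?T n + ?D n"
      using max_chordal_edges(1)[OF fE] nup by (metis not_less)
    ultimately show ?thesis using F(3) \<gamma> by (simp add: abs_le_iff)
  qed
  \<comment> \<open>The union bound over the two tails, written for the complementary event.\<close>
  have lo: "1 - (U n + L n) \<le> prob_Gnp n p (?ev n)" for n
  proof -
    have "1 - (U n + L n) = bern p (all_pairs n) (\<lambda>E. 1 - (of_bool (?up n E) + of_bool (?low n E)))"
      unfolding U_def L_def by (simp only: bern_diff bern_add bern_const[OF finite_all_pairs])
    also have "\<dots> \<le> bern p (all_pairs n) (\<lambda>E. of_bool (?ev n E))"
    proof (rule bern_mono)
      fix E assume E: "E \<subseteq> all_pairs n"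
      have key: "1 - (of_bool A + of_bool B) \<le> (of_bool P :: real)" if "\<not> A \<Longrightarrow> \<not> B \<Longrightarrow> P" for P A B
        using that by (cases P; cases A; cases B) auto
      show "1 - (of_bool (?up n E) + of_bool (?low n E)) \<le> (of_bool (?ev n E) :: real)"
        by (rule key) (rule ev[OF E])
    qed (use assms in auto)
    finally show ?thesis by (simp only: prob_Gnp_eq_bern)
  qed
  have hi: "prob_Gnp n p (?ev n) \<le> 1" for n
  proof -
    have "prob_Gnp n p (?ev n) \<le> bern p (all_pairs n) (\<lambda>_. 1)"
      unfolding prob_Gnp_eq_bern using assms by (intro bern_mono) auto
    then show ?thesis by simp
  qed
  show ?thesis
  proof (rule tendsto_sandwich[of "\<lambda>n. 1 - (U n + L n)" _ _ "\<lambda>_. 1"])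
    show "(\<lambda>n. 1 - (U n + L n)) \<longlonglongrightarrow> 1" using lim by simp
  qed (simp_all only: lo hi eventually_True tendsto_const)
qed


end
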